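(* Let $\mathcal{A}=M_{n_1}\oplus\cdots\oplus M_{n_d}$, viewed as the block-diagonal subalgebra of $M_m$ with $m=n_1+\cdots+n_d$, let $\tau$ be a completely positive map on $\mathcal{A}$ and $\widetilde{\tau}$ its canonical extension to $M_m$. The following are equivalent: (1) $\tau$ is irreducible; (2) $\widetilde{\tau}$ is irreducible; (3) there exist $A_1,\dots,A_p\in M_m$ generating $M_m$ as an algebra such that $\widetilde{\tau}(X)=\sum_{i=1}^pA_i^*XA_i$ for all $X\in M_m$ (in particular $\tau(X)=\sum_{i=1}^pA_i^*XA_i$ for all $X\in\mathcal{A}$); (4) there exist $A_1,\dots,A_p\in M_m$ generating $M_m$ as an algebra such that $\tau(X)=\sum_{i=1}^pA_i^*XA_i$ for all $X\in\mathcal{A}$.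
   Context: The canonical extension is $\widetilde{\tau}=\iota\circ\tau\circ\phi$, where $\iota:\mathcal{A}\hookrightarrow M_m$ is the block-diagonal embedding and $\phi:M_m\to\mathcal{A}$ maps a block matrix $(X_{ij})$ to its block-diagonal part $X_{11}\oplus\cdots\oplus X_{dd}$. A positive map $\varphi$ on a finite dimensional $C^*$-algebra $\mathcal{B}$ is irreducible if there is no projection $p\in\mathcal{B}$, $p\ne0,1$, with $\varphi(p\mathcal{B}p)\subseteq p\mathcal{B}p$. *)

theory Defs
  imports Complex_Main "Jordan_Normal_Form.Matrix"
begin

definition cadj :: "complex mat \<Rightarrow> complex mat" where
  "cadj X = mat (dim_col X) (dim_row X) (\<lambda>(i,j). cnj (X $$ (j,i)))"

definition psd :: "nat \<Rightarrow> complex mat \<Rightarrow> bool" where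
  "psd n X \<longleftrightarrow> X \<in> carrier_mat n n \<and>
     (\<forall>v \<in> carrier_vec n. (\<Sum>i<n. cnj (v $ i) * (X *\<^sub>v v) $ i) \<in> \<real> \<and>
                         Re (\<Sum>i<n. cnj (v $ i) * (X *\<^sub>v v) $ i) \<ge> 0)"

fun blk :: "nat list \<Rightarrow> nat \<Rightarrow> nat" where
  "blk [] i = 0"
| "blk (n # ns) i = (if i < n then 0 else Suc (blk ns (i - n)))"

definition blockalg :: "nat list \<Rightarrow> complex mat set" where
  "blockalg ns = {X \<in> carrier_mat (sum_list ns) (sum_list ns).
      \<forall>i < sum_list ns. \<forall>j < sum_list ns. blk ns i \<noteq> blk ns j \<longrightarrow> X $$ (i,j) = 0}"

definition bdiag_part :: "nat list \<Rightarrow> complex mat \<Rightarrow> complex mat" where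
  "bdiag_part ns X = mat (sum_list ns) (sum_list ns)
      (\<lambda>(i,j). if blk ns i = blk ns j then X $$ (i,j) else 0)"

text \<open>Canonical extension: iota o tau o phi (iota is the inclusion, i.e. identity on matrices).\<close>
definition canon_ext :: "nat list \<Rightarrow> (complex mat \<Rightarrow> complex mat) \<Rightarrow> complex mat \<Rightarrow> complex mat" where
  "canon_ext ns \<tau> X = \<tau> (bdiag_part ns X)"

definition assemble :: "nat \<Rightarrow> nat \<Rightarrow> (nat \<Rightarrow> nat \<Rightarrow> complex mat) \<Rightarrow> complex mat" where
  "assemble k m X = mat (k*m) (k*m) (\<lambda>(i,j). X (i div m) (j div m) $$ (i mod m, j mod m))"

definition lin_on :: "complex mat set \<Rightarrow> (complex mat \<Rightarrow> complex mat) \<Rightarrow> bool" where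
  "lin_on B \<tau> \<longleftrightarrow> (\<forall>X\<in>B. \<tau> X \<in> B) \<and>
     (\<forall>X\<in>B. \<forall>Y\<in>B. \<tau> (X + Y) = \<tau> X + \<tau> Y) \<and>
     (\<forall>X\<in>B. \<forall>c. \<tau> (c \<cdot>\<^sub>m X) = c \<cdot>\<^sub>m \<tau> X)"

text \<open>Completely positive map on a C*-subalgebra B of M_m: linear, B-valued, and
  id_k tensor tau is positive on M_k(B) (a subalgebra of M_{km}) for every k.\<close>
definition completely_positive :: "nat \<Rightarrow> complex mat set \<Rightarrow> (complex mat \<Rightarrow> complex mat) \<Rightarrow> bool" where
  "completely_positive m B \<tau> \<longleftrightarrow> lin_on B \<tau> \<and>
     (\<forall>k X. (\<forall>i<k. \<forall>j<k. X i j \<in> B) \<longrightarrow> psd (k*m) (assemble k m X) \<longrightarrow>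
            psd (k*m) (assemble k m (\<lambda>i j. \<tau> (X i j))))"

definition projection :: "nat \<Rightarrow> complex mat \<Rightarrow> bool" where
  "projection m P \<longleftrightarrow> P \<in> carrier_mat m m \<and> cadj P = P \<and> P * P = P"

definition irreducible_map :: "nat \<Rightarrow> complex mat set \<Rightarrow> (complex mat \<Rightarrow> complex mat) \<Rightarrow> bool" where
  "irreducible_map m B \<tau> \<longleftrightarrow>
     \<not> (\<exists>P \<in> B. projection m P \<and> P \<noteq> 0\<^sub>m m m \<and> P \<noteq> 1\<^sub>m m \<and>
           \<tau> ` {P * X * P | X. X \<in> B} \<subseteq> {P * X * P | X. X \<in> B})"

inductive_set gen_alg :: "nat \<Rightarrow> complex mat set \<Rightarrow> complex mat set" for m S where
  gen: "A \<in> S \<Longrightarrow> A \<in> carrier_mat m m \<Longrightarrow> A \<in> gen_alg m S"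
| one: "1\<^sub>m m \<in> gen_alg m S"
| add: "A \<in> gen_alg m S \<Longrightarrow> B \<in> gen_alg m S \<Longrightarrow> A + B \<in> gen_alg m S"
| mult: "A \<in> gen_alg m S \<Longrightarrow> B \<in> gen_alg m S \<Longrightarrow> A * B \<in> gen_alg m S"
| smult: "A \<in> gen_alg m S \<Longrightarrow> c \<cdot>\<^sub>m A \<in> gen_alg m S"

definition kraus_sum :: "nat \<Rightarrow> complex mat list \<Rightarrow> complex mat \<Rightarrow> complex mat" where
  "kraus_sum m As X = foldr (\<lambda>A acc. cadj A * X * A + acc) As (0\<^sub>m m m)"

end

theory Submission
  imports Defs "Jordan_Normal_Form.Spectral_Radius"
begin

text \<open>Complete positivity, applied to the matrix of block-diagonal parts of the matrix units, makes the
  Choi matrix of the canonical extension positive, which yields Kraus operators \<open>A\<^sub>i\<close>. For any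
  Kraus family, a projection \<open>P\<close> reduces the map iff \<open>P A\<^sub>i (1 - P) = 0\<close> for all \<open>i\<close>, that
  is, iff the kernel of \<open>P\<close> is invariant under all \<open>A\<^sub>i\<close>. This criterion is the same on the block
  algebra and on the full matrix algebra, so Burnside's theorem links irreducibility to generation.

  To pass from a reducing projection in the full algebra to one in the block algebra, note that the
  canonical extension factors through the block-diagonal part and has block-diagonal values. So the
  blocks \<open>p\<^sub>a A\<^sub>i p\<^sub>b\<close> form a Kraus family too, and an invariant subspace of those can be
  replaced by a graded one, whose orthogonal projection is block-diagonal.\<close>

section \<open>Positive semidefinite forms\<close>

text \<open>The reducing criterion rests on one identity: for \<open>Q = 1 - P\<close> the
  compression of \<open>\<tau> P\<close> by \<open>Q\<close> is the sum of \<open>cadj B * B\<close>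
  over \<open>B = P * A * Q\<close>, so it can vanish only termwise. Two obstacles shape the rest.
  Choi's argument evaluates a map at matrix units, which leave the block algebra when row and column
  belong to different blocks; their block-diagonal parts can stand in for them exactly because the
  extension does not see the difference. Moreover, a Kraus family of \<open>\<tau>\<close> on the
  block algebra need not represent the extension, so condition (4) does not lead back to (3) with
  the same operators. The criterion is therefore proved for an arbitrary Kraus family and an
  arbitrary set \<open>B\<close> of matrices that contains the identity and is closed under
  products, and (4) returns directly to (1). The generated algebra contains the identity. This
  matters for \<open>m = 1\<close> and the zero map: there is no proper projection, so the map is
  irreducible, and the empty family has to generate.\<close>

definition psd_form :: "'a set \<Rightarrow> ('a \<Rightarrow> 'a \<Rightarrow> complex) \<Rightarrow> bool" where
  "psd_form I C \<longleftrightarrow> (\<forall>v. (\<Sum>i\<in>I. \<Sum>j\<in>I. cnj (v i) * C i j * v j) \<in> \<real> \<and>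
     Re (\<Sum>i\<in>I. \<Sum>j\<in>I. cnj (v i) * C i j * v j) \<ge> 0)"

text \<open>Forms are indexed by an arbitrary finite set so that an induction may delete an index;
  this splitting into corner, two borders and the remaining form is what the induction step computes
  with.\<close>

lemma psd_form_insert_sum:
  assumes "finite J" "a \<notin> J"
  shows "(\<Sum>i\<in>insert a J. \<Sum>j\<in>insert a J. cnj (v i) * C i j * (v j :: complex)) =
    cnj (v a) * C a a * v a + cnj (v a) * (\<Sum>j\<in>J. C a j * v j)
    + (\<Sum>i\<in>J. cnj (v i) * C i a) * v a + (\<Sum>i\<in>J. \<Sum>j\<in>J. cnj (v i) * C i j * v j)"
  using assms by (simp add: sum.distrib sum_distrib_left sum_distrib_right algebra_simps)

text \<open>Testing on vectors supported at two indices. Everything known about off-diagonal entries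
  comes from special choices of \<open>s\<close> and \<open>t\<close>.\<close>

lemma psd_form_two:
  assumes "psd_form I C" "finite I" "a \<in> I" "b \<in> I" "a \<noteq> b"
  shows "cnj s * C a a * s + cnj s * C a b * t + cnj t * C b a * s + cnj t * C b b * t \<in> \<real>"
    and "Re (cnj s * C a a * s + cnj s * C a b * t + cnj t * C b a * s + cnj t * C b b * t) \<ge> 0"
proof -
  define v where "v = (\<lambda>i. if i = a then s else if i = b then t else 0)"
  have s: "(\<Sum>i\<in>I. f i) = f a + f b" if "\<And>i. i \<noteq> a \<Longrightarrow> i \<noteq> b \<Longrightarrow> f i = 0" for f :: "'a \<Rightarrow> complex"
  proof -
    have "sum f I = sum f {a, b}"
      by (rule sum.mono_neutral_right) (use assms that in auto)
    then show ?thesis using assms by simp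
  qed
  have "(\<Sum>i\<in>I. \<Sum>j\<in>I. cnj (v i) * C i j * v j) = (\<Sum>i\<in>I. cnj (v i) * C i a * s + cnj (v i) * C i b * t)"
    by (rule sum.cong[OF refl], subst s) (use assms in \<open>auto simp: v_def\<close>)
  also have "\<dots> = cnj s * C a a * s + cnj s * C a b * t + cnj t * C b a * s + cnj t * C b b * t"
    by (subst s) (use assms in \<open>auto simp: v_def\<close>)
  finally have eq: "(\<Sum>i\<in>I. \<Sum>j\<in>I. cnj (v i) * C i j * v j)
    = cnj s * C a a * s + cnj s * C a b * t + cnj t * C b a * s + cnj t * C b b * t" .
  from assms(1)[unfolded psd_form_def, rule_format, of v] show
    "cnj s * C a a * s + cnj s * C a b * t + cnj t * C b a * s + cnj t * C b b * t \<in> \<real>"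
    "Re (cnj s * C a a * s + cnj s * C a b * t + cnj t * C b a * s + cnj t * C b b * t) \<ge> 0"
    unfolding eq by auto
qed

lemma psd_form_diag:
  assumes "psd_form I C" "finite I" "a \<in> I"
  shows "C a a = of_real (Re (C a a))" "Re (C a a) \<ge> 0"
proof -
  define v where "v = (\<lambda>i. if i = a then 1 else 0 :: complex)"
  have "(\<Sum>i\<in>I. \<Sum>j\<in>I. cnj (v i) * C i j * v j) = (\<Sum>i\<in>I. \<Sum>j\<in>I. if j = a then (if i = a then C a a else 0) else 0)"
    by (intro sum.cong refl) (auto simp: v_def)
  also have "\<dots> = C a a" using assms by simp
  finally have eq: "(\<Sum>i\<in>I. \<Sum>j\<in>I. cnj (v i) * C i j * v j) = C a a" .
  from assms(1)[unfolded psd_form_def, rule_format, of v] show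
    "C a a = of_real (Re (C a a))" "Re (C a a) \<ge> 0"
    unfolding eq by (auto simp: complex_is_Real_iff complex_eq_iff)
qed

text \<open>Polarization: since the form is real, the test vector (1, 1) relates the imaginary parts
  of the two off-diagonal entries, and (1, i) relates their real parts.\<close>

lemma psd_form_hermitian:
  assumes "psd_form I C" "finite I" "a \<in> I" "b \<in> I"
  shows "C b a = cnj (C a b)"
proof (cases "a = b")
  case True
  then show ?thesis using psd_form_diag[OF assms(1-3)]
    by (metis complex_cnj_complex_of_real)
next
  case False
  note t = psd_form_two[OF assms False] and d = psd_form_diag[OF assms(1,2,3)] psd_form_diag[OF assms(1,2,4)]
  have "Im (C a a) = 0" "Im (C b b) = 0" using d by (metis Im_complex_of_real)+
  then have "Im (C a b) = - Im (C b a)" "Re (C a b) = Re (C b a)"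
    using t(1)[of 1 1] t(1)[of 1 \<i>] by (auto simp: complex_is_Real_iff)
  then show ?thesis by (simp add: complex_eq_iff)
qed

lemma psd_form_zero_diag:
  assumes "psd_form I C" "finite I" "a \<in> I" "b \<in> I" "C a a = 0"
  shows "C a b = 0"
proof (rule ccontr)
  assume n: "C a b \<noteq> 0"
  then have ne: "a \<noteq> b" using assms by auto
  define x where "x = C a b"
  define N where "N = (cmod x)\<^sup>2"
  have N: "N > 0" "x * cnj x = of_real N"
    using n complex_norm_square[of x] by (auto simp: N_def x_def)
  \<comment> \<open>Large enough to force a contradiction: at \<open>s = - r x\<close>,
    \<open>t = 1\<close> the form has real part \<open>- 2 (Re (C b b) + 1) + Re (C b b)\<close>,
    which is negative.\<close>
  define r where "r = (Re (C b b) + 1) / N"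
  have h: "C b a = cnj x" unfolding x_def by (rule psd_form_hermitian[OF assms(1-4)])
  have "cnj (- of_real r * x) * x + cnj x * (- of_real r * x) = - 2 * of_real r * (x * cnj x)"
    by (simp add: algebra_simps)
  also have "\<dots> = of_real (- 2 * (r * N))" using N by simp
  finally have "Re (cnj (- of_real r * x) * x + cnj x * (- of_real r * x)) = - 2 * (r * N)"
    using Re_complex_of_real by metis
  moreover have "r * N = Re (C b b) + 1" using N by (simp add: r_def)
  ultimately show False
    using psd_form_two(2)[OF assms(1-4) ne, of "- of_real r * x" 1] psd_form_diag(2)[OF assms(1,2,4)]
    by (simp add: assms(5) h x_def[symmetric])
qed

text \<open>The induction step removes an index by passing to the Schur complement.\<close>
lemma psd_form_decomposition:
  assumes "finite I" "psd_form I C"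
  shows "\<exists>ws :: ('a \<Rightarrow> complex) list. \<forall>i\<in>I. \<forall>j\<in>I. C i j = (\<Sum>w\<leftarrow>ws. w i * cnj (w j))"
  using assms
proof (induction I arbitrary: C rule: finite_induct)
  case empty
  then show ?case by auto
next
  case (insert a J)
  let ?I = "insert a J"
  have fI: "finite ?I" using insert by simp
  note herm = psd_form_hermitian[OF insert.prems fI]
  define c where "c = Re (C a a)"
  have c: "C a a = of_real c" "c \<ge> 0"
    using psd_form_diag[OF insert.prems fI, of a] unfolding c_def by auto
  have z: "C a j = 0" "C j a = 0" if "c = 0" "j \<in> ?I" for j
    using psd_form_zero_diag[OF insert.prems fI, of a j] herm[of a j] that c by auto
  \<comment> \<open>Column \<open>a\<close>, scaled so that the rank-one form of \<open>w\<close>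
    agrees with \<open>C\<close> in row and column \<open>a\<close>. For \<open>c = 0\<close> that
    column vanishes, and so does \<open>w\<close>, as division by zero yields zero.\<close>
  define w where "w j = C j a / of_real (sqrt c)" for j
  have wa: "C j a = w j * cnj (w a)" "C a j = w a * cnj (w j)" if "j \<in> ?I" for j
  proof -
    have wc: "w a = of_real (sqrt c)" unfolding w_def c
      using c(2) by (metis of_real_divide real_div_sqrt)
    show 1: "C j a = w j * cnj (w a)"
      using z[of j] that unfolding wc by (cases "c = 0") (auto simp: w_def)
    show "C a j = w a * cnj (w j)"
      using herm[of j a] 1 that by simp
  qed
  define C' where "C' i j = C i j - w i * cnj (w j)" for i j
  have "psd_form J C'"
    unfolding psd_form_def
  proof
    fix v :: "'a \<Rightarrow> complex"
    define s where "s = (\<Sum>j\<in>J. C a j * v j)"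
    \<comment> \<open>The value at \<open>a\<close> completes the square, so that the form of
      \<open>C\<close> at \<open>v'\<close> equals the form of \<open>C'\<close> at
      \<open>v\<close>. For \<open>c = 0\<close> the quotient is zero, in line with
      \<open>w\<close>.\<close>
    define v' where "v' = v(a := - s / of_real c)"
    have vJ: "v' j = v j" if "j \<in> J" for j using that insert.hyps by (auto simp: v'_def)
    have cs: "(\<Sum>i\<in>J. cnj (v i) * C i a) = cnj s"
      unfolding s_def cnj_sum by (rule sum.cong) (use herm[of a] in \<open>auto simp: mult.commute\<close>)
    have "(\<Sum>i\<in>?I. \<Sum>j\<in>?I. cnj (v' i) * C i j * v' j) =
      cnj (v' a) * C a a * v' a + cnj (v' a) * s + cnj s * v' a + (\<Sum>i\<in>J. \<Sum>j\<in>J. cnj (v i) * C i j * v j)"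
      unfolding psd_form_insert_sum[OF insert.hyps] using vJ cs by (simp add: s_def cong: sum.cong)
    also have "cnj (v' a) * C a a * v' a + cnj (v' a) * s + cnj s * v' a = - (cnj s * s / of_real c)"
      using c by (cases "c = 0") (auto simp: v'_def field_simps)
    also have "cnj s * s / of_real c = (\<Sum>i\<in>J. \<Sum>j\<in>J. cnj (v i) * (w i * cnj (w j)) * v j)"
    proof -
      have "(\<Sum>i\<in>J. \<Sum>j\<in>J. cnj (v i) * (w i * cnj (w j)) * v j)
        = (\<Sum>i\<in>J. cnj (v i) * w i) * (\<Sum>j\<in>J. cnj (w j) * v j)"
        unfolding sum_product by (intro sum.cong refl) (simp add: algebra_simps)
      also have "(\<Sum>i\<in>J. cnj (v i) * w i) = cnj s / of_real (sqrt c)"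
        unfolding cs[symmetric] w_def by (simp add: sum_divide_distrib)
      also have "(\<Sum>j\<in>J. cnj (w j) * v j) = s / of_real (sqrt c)"
        unfolding s_def w_def sum_divide_distrib
        by (rule sum.cong) (use herm[of _ a] in auto)
      finally show ?thesis using c(2) by (simp flip: of_real_mult)
    qed
    finally have "(\<Sum>i\<in>?I. \<Sum>j\<in>?I. cnj (v' i) * C i j * v' j) = (\<Sum>i\<in>J. \<Sum>j\<in>J. cnj (v i) * C' i j * v j)"
      by (simp add: C'_def algebra_simps sum_subtractf)
    then show "(\<Sum>i\<in>J. \<Sum>j\<in>J. cnj (v i) * C' i j * v j) \<in> \<real> \<and>
      0 \<le> Re (\<Sum>i\<in>J. \<Sum>j\<in>J. cnj (v i) * C' i j * v j)"
      using insert.prems[unfolded psd_form_def, rule_format, of v'] by simp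
  qed
  from insert.IH[OF this] obtain ws where ws: "\<forall>i\<in>J. \<forall>j\<in>J. C' i j = (\<Sum>w\<leftarrow>ws. w i * cnj (w j))"
    by auto
  \<comment> \<open>The vectors from the induction hypothesis are arbitrary at \<open>a\<close>;
    zeroing them there leaves row and column \<open>a\<close> to \<open>w\<close> alone.\<close>
  define us where "us = w # map (\<lambda>w. w(a := 0)) ws"
  have "C i j = (\<Sum>w\<leftarrow>us. w i * cnj (w j))" if "i \<in> ?I" "j \<in> ?I" for i j
  proof (cases "i = a \<or> j = a")
    case True
    have "(\<Sum>w\<leftarrow>map (\<lambda>w. w(a := 0)) ws. w i * cnj (w j)) = 0"
      using True by (induction ws) auto
    then show ?thesis using True wa that unfolding us_def by auto
  next
    case False
    then have "(\<Sum>w\<leftarrow>map (\<lambda>w. w(a := 0)) ws. w i * cnj (w j)) = C' i j"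
      using ws that by (simp add: o_def)
    then show ?thesis unfolding us_def C'_def by simp
  qed
  then show ?case by blast
qed

section \<open>Subspaces and isometries\<close>

lemma dim_cadj [simp]: "dim_row (cadj A) = dim_col A" "dim_col (cadj A) = dim_row A"
  unfolding cadj_def by auto

lemma cadj_carrier: "A \<in> carrier_mat n k \<Longrightarrow> cadj A \<in> carrier_mat k n"
  unfolding cadj_def by auto

lemma cadj_index [simp]: "A \<in> carrier_mat n k \<Longrightarrow> i < k \<Longrightarrow> j < n \<Longrightarrow> cadj A $$ (i, j) = cnj (A $$ (j, i))"
  unfolding cadj_def by auto

lemma cadj_cadj [simp]: "cadj (cadj A) = A"
  unfolding cadj_def by (intro eq_matI) auto

lemma mult_index:
  assumes "A \<in> carrier_mat n k" "B \<in> carrier_mat k l" "i < n" "j < l"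
  shows "(A * B) $$ (i, j) = (\<Sum>t<k. A $$ (i, t) * B $$ (t, j))"
  using assms by (auto simp: scalar_prod_def lessThan_atLeast0 intro!: sum.cong)

lemma mult_vec_index:
  assumes "A \<in> carrier_mat n k" "v \<in> carrier_vec k" "i < n"
  shows "(A *\<^sub>v v) $ i = (\<Sum>t<k. A $$ (i, t) * v $ t)"
  using assms by (auto simp: scalar_prod_def lessThan_atLeast0 intro!: sum.cong)

lemma cadj_mult:
  assumes "A \<in> carrier_mat n k" "B \<in> carrier_mat k l"
  shows "cadj (A * B) = cadj B * cadj A"
proof (rule eq_matI)
  have AB: "A * B \<in> carrier_mat n l" using assms by simp
  have c: "cadj B * cadj A \<in> carrier_mat l n"
    using mult_carrier_mat[OF cadj_carrier[OF assms(2)] cadj_carrier[OF assms(1)]] .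
  show "dim_row (cadj (A * B)) = dim_row (cadj B * cadj A)"
    "dim_col (cadj (A * B)) = dim_col (cadj B * cadj A)"
    using cadj_carrier[OF AB] c by auto
  fix i j assume "i < dim_row (cadj B * cadj A)" "j < dim_col (cadj B * cadj A)"
  then have ij: "i < l" "j < n" using c by auto
  show "cadj (A * B) $$ (i, j) = (cadj B * cadj A) $$ (i, j)"
    unfolding cadj_index[OF AB ij] mult_index[OF assms ij(2) ij(1)]
      mult_index[OF cadj_carrier[OF assms(2)] cadj_carrier[OF assms(1)] ij] cnj_sum
    by (rule sum.cong) (use ij assms in \<open>auto simp: mult.commute\<close>)
qed

lemma cinner_eq: "w \<in> carrier_vec n \<Longrightarrow> v \<bullet>c w = (\<Sum>i<n. v $ i * cnj (w $ i))"
  by (auto simp: scalar_prod_def lessThan_atLeast0 intro!: sum.cong)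

lemma cinner_cadj:
  assumes "A \<in> carrier_mat n k" "v \<in> carrier_vec k" "w \<in> carrier_vec n"
  shows "(A *\<^sub>v v) \<bullet>c w = v \<bullet>c (cadj A *\<^sub>v w)"
proof -
  have c: "cadj A *\<^sub>v w \<in> carrier_vec k" using cadj_carrier[OF assms(1)] assms(3) by simp
  have "(A *\<^sub>v v) \<bullet>c w = (\<Sum>i<n. \<Sum>t<k. A $$ (i, t) * v $ t * cnj (w $ i))"
    unfolding cinner_eq[OF assms(3)] by (rule sum.cong)
      (auto simp: mult_vec_index[OF assms(1,2)] sum_distrib_right simp del: index_mult_mat_vec)
  also have "\<dots> = (\<Sum>t<k. \<Sum>i<n. A $$ (i, t) * v $ t * cnj (w $ i))" by (rule sum.swap)
  also have "\<dots> = v \<bullet>c (cadj A *\<^sub>v w)"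
    unfolding cinner_eq[OF c]
    by (rule sum.cong) (use assms in \<open>auto simp: mult_vec_index[OF cadj_carrier[OF assms(1)] assms(3)]
      sum_distrib_left algebra_simps simp del: index_mult_mat_vec intro!: sum.cong\<close>)
  finally show ?thesis .
qed

lemma cinner_self:
  assumes "v \<in> carrier_vec n"
  shows "v \<bullet>c v = of_real (\<Sum>i<n. (cmod (v $ i))\<^sup>2)"
  unfolding cinner_eq[OF assms] of_real_sum by (rule sum.cong) (auto simp: complex_norm_square simp flip: of_real_power)

lemma cinner_self_zero:
  fixes v :: "complex vec"
  assumes "v \<in> carrier_vec n"
  shows "v \<bullet>c v = 0 \<longleftrightarrow> v = 0\<^sub>v n"
proof -
  have "v \<bullet>c v = 0 \<longleftrightarrow> (\<forall>i<n. v $ i = 0)"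
    unfolding cinner_self[OF assms] of_real_eq_0_iff by (auto simp: sum_nonneg_eq_0_iff)
  also have "\<dots> \<longleftrightarrow> v = 0\<^sub>v n" using assms by (auto intro!: eq_vecI)
  finally show ?thesis .
qed

section \<open>Subspaces and orthonormal families\<close>

definition csubspace :: "nat \<Rightarrow> complex vec set \<Rightarrow> bool" where
  "csubspace m K \<longleftrightarrow> K \<subseteq> carrier_vec m \<and> 0\<^sub>v m \<in> K \<and>
     (\<forall>v\<in>K. \<forall>w\<in>K. v + w \<in> K) \<and> (\<forall>c. \<forall>v\<in>K. c \<cdot>\<^sub>v v \<in> K)"

lemma csubspaceI:
  assumes "K \<subseteq> carrier_vec m" "0\<^sub>v m \<in> K" "\<And>v w. v \<in> K \<Longrightarrow> w \<in> K \<Longrightarrow> v + w \<in> K"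
    "\<And>c v. v \<in> K \<Longrightarrow> c \<cdot>\<^sub>v v \<in> K"
  shows "csubspace m K"
  using assms unfolding csubspace_def by auto

lemma csubspaceD:
  assumes "csubspace m K"
  shows "v \<in> K \<Longrightarrow> v \<in> carrier_vec m" "0\<^sub>v m \<in> K"
    "v \<in> K \<Longrightarrow> w \<in> K \<Longrightarrow> v + w \<in> K" "v \<in> K \<Longrightarrow> c \<cdot>\<^sub>v v \<in> K"
    "v \<in> K \<Longrightarrow> w \<in> K \<Longrightarrow> v - w \<in> K"
proof -
  show a: "v \<in> K \<Longrightarrow> v \<in> carrier_vec m" "0\<^sub>v m \<in> K"
    "v \<in> K \<Longrightarrow> w \<in> K \<Longrightarrow> v + w \<in> K" "v \<in> K \<Longrightarrow> c \<cdot>\<^sub>v v \<in> K" for v w c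
    using assms unfolding csubspace_def by auto
  assume vw: "v \<in> K" "w \<in> K"
  have "v - w = v + (-1) \<cdot>\<^sub>v w" using a(1)[OF vw(1)] a(1)[OF vw(2)] by (intro eq_vecI) auto
  then show "v - w \<in> K" using a vw by metis
qed

text \<open>The columns of \<open>V\<close> form an orthonormal family of size \<open>r\<close> in
  \<open>K\<close>. Storing the family as a matrix makes the projection onto its span available as
  \<open>V * cadj V\<close>.\<close>

definition isometry_into :: "nat \<Rightarrow> nat \<Rightarrow> complex vec set \<Rightarrow> complex mat \<Rightarrow> bool" where
  "isometry_into m r K V \<longleftrightarrow> V \<in> carrier_mat m r \<and> cadj V * V = 1\<^sub>m r \<and> (\<forall>u\<in>carrier_vec r. V *\<^sub>v u \<in> K)"

text \<open>If \<open>V\<close> had more columns than rows, padding it with zero rows would give a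
  square \<open>U\<close> with the same \<open>cadj U * U\<close>. A one-sided inverse of a square
  matrix is two-sided, yet \<open>U * cadj U\<close> has a zero at position
  \<open>(m, m)\<close>.\<close>

lemma isometry_into_le:
  assumes "isometry_into m r K V"
  shows "r \<le> m"
proof (rule ccontr)
  assume "\<not> r \<le> m"
  then have lt: "m < r" by simp
  from assms have V: "V \<in> carrier_mat m r" and VV: "cadj V * V = 1\<^sub>m r"
    unfolding isometry_into_def by auto
  define U where "U = mat r r (\<lambda>(i, j). if i < m then V $$ (i, j) else 0)"
  have U: "U \<in> carrier_mat r r" unfolding U_def by simp
  have "cadj U * U = cadj V * V"
  proof (rule eq_matI)
    fix i j assume "i < dim_row (cadj V * V)" "j < dim_col (cadj V * V)"
    then have ij: "i < r" "j < r" using V cadj_carrier[OF V] by auto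
    have "(\<Sum>t<r. cadj U $$ (i, t) * U $$ (t, j)) = (\<Sum>t<m. cadj V $$ (i, t) * V $$ (t, j))"
      by (rule sum.mono_neutral_cong_right) (use lt ij U V in \<open>auto simp: U_def[symmetric]\<close>, auto simp: U_def)
    then show "(cadj U * U) $$ (i, j) = (cadj V * V) $$ (i, j)"
      unfolding mult_index[OF cadj_carrier[OF U] U ij] mult_index[OF cadj_carrier[OF V] V ij] .
  qed (use U V cadj_carrier[OF U] cadj_carrier[OF V] in auto)
  then have "U * cadj U = 1\<^sub>m r"
    using mat_mult_left_right_inverse[OF cadj_carrier[OF U] U] VV by simp
  then have "(U * cadj U) $$ (m, m) = 1" using lt by simp
  moreover have "(U * cadj U) $$ (m, m) = 0"
    unfolding mult_index[OF U cadj_carrier[OF U] lt lt] by (rule sum.neutral) (use lt in \<open>auto simp: U_def\<close>)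
  ultimately show False by simp
qed

text \<open>One Gram-Schmidt step: the residual \<open>z\<close> of \<open>v\<close> lies in
  \<open>K\<close>, is nonzero and is orthogonal to all columns of \<open>V\<close>, so its
  normalization serves as a further column.\<close>

lemma isometry_into_extend:
  assumes K: "csubspace m K" and V: "isometry_into m r K V"
    and v: "v \<in> K" "V *\<^sub>v (cadj V *\<^sub>v v) \<noteq> v"
  shows "\<exists>V'. isometry_into m (Suc r) K V'"
proof -
  note Kd = csubspaceD[OF K]
  from V have Vc: "V \<in> carrier_mat m r" and VV: "cadj V * V = 1\<^sub>m r" and VK: "\<And>u. u \<in> carrier_vec r \<Longrightarrow> V *\<^sub>v u \<in> K"
    unfolding isometry_into_def by auto
  note Va = cadj_carrier[OF Vc]
  have vc: "v \<in> carrier_vec m" using Kd v by auto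
  have cv: "cadj V *\<^sub>v v \<in> carrier_vec r" using Va vc by simp
  define z where "z = v - V *\<^sub>v (cadj V *\<^sub>v v)"
  have zK: "z \<in> K" unfolding z_def using Kd(5)[OF v(1) VK[OF cv]] .
  have zc: "z \<in> carrier_vec m" using Kd zK by auto
  have Vz: "cadj V *\<^sub>v z = 0\<^sub>v r"
  proof -
    have "cadj V *\<^sub>v z = cadj V *\<^sub>v v - cadj V *\<^sub>v (V *\<^sub>v (cadj V *\<^sub>v v))"
      unfolding z_def using Va vc VK[OF cv] Kd(1) by (intro mult_minus_distrib_mat_vec) auto
    also have "cadj V *\<^sub>v (V *\<^sub>v (cadj V *\<^sub>v v)) = (cadj V * V) *\<^sub>v (cadj V *\<^sub>v v)"
      using Va Vc cv by (intro assoc_mult_mat_vec[symmetric]) auto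
    finally show ?thesis using VV cv by simp
  qed
  have z0: "z \<noteq> 0\<^sub>v m"
  proof
    assume "z = 0\<^sub>v m"
    then have "v = V *\<^sub>v (cadj V *\<^sub>v v)"
      using vc Vc unfolding z_def by (auto simp: vec_eq_iff)
    then show False using v by simp
  qed
  define N where "N = (\<Sum>i<m. (cmod (z $ i))\<^sup>2)"
  have zz: "z \<bullet>c z = of_real N" unfolding N_def using cinner_self[OF zc] .
  have N: "N > 0"
  proof -
    have "N \<noteq> 0" using zz z0 cinner_self_zero[OF zc] by auto
    moreover have "N \<ge> 0" unfolding N_def by (simp add: sum_nonneg)
    ultimately show ?thesis by simp
  qed
  define y where "y = of_real (1 / sqrt N) \<cdot>\<^sub>v z"
  have yc: "y \<in> carrier_vec m" and yK: "y \<in> K" using zc Kd zK unfolding y_def by auto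
  have yy: "(\<Sum>t<m. cnj (y $ t) * y $ t) = 1"
  proof -
    have "(\<Sum>t<m. cnj (y $ t) * y $ t) = (\<Sum>t<m. of_real (1 / N) * (z $ t * cnj (z $ t)))"
    proof (rule sum.cong[OF refl])
      fix t assume "t \<in> {..<m}"
      then have "y $ t = of_real (1 / sqrt N) * z $ t" unfolding y_def using zc by auto
      moreover have "cnj (of_real a * x) * (of_real a * x) = of_real (a * a) * (x * cnj x)" for a x
        by (simp add: algebra_simps)
      ultimately have "cnj (y $ t) * y $ t = of_real (1 / sqrt N * (1 / sqrt N)) * (z $ t * cnj (z $ t))"
        by metis
      also have "1 / sqrt N * (1 / sqrt N) = 1 / N" using N by simp
      finally show "cnj (y $ t) * y $ t = of_real (1 / N) * (z $ t * cnj (z $ t))" .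
    qed
    also have "\<dots> = of_real (1 / N) * (z \<bullet>c z)" unfolding cinner_eq[OF zc] sum_distrib_left ..
    also have "\<dots> = 1" unfolding zz using N by simp
    finally show ?thesis .
  qed
  have Vy: "(\<Sum>t<m. cnj (V $$ (t, i)) * y $ t) = 0" if "i < r" for i
  proof -
    have "(\<Sum>t<m. cnj (V $$ (t, i)) * y $ t) = (cadj V *\<^sub>v y) $ i"
      unfolding mult_vec_index[OF Va yc that] using Vc that by (intro sum.cong) auto
    also have "cadj V *\<^sub>v y = of_real (1 / sqrt N) \<cdot>\<^sub>v (cadj V *\<^sub>v z)"
      unfolding y_def using Va zc by (rule mult_mat_vec)
    finally show ?thesis using that Vz by simp
  qed
  define V' where "V' = mat m (Suc r) (\<lambda>(i, j). if j < r then V $$ (i, j) else y $ i)"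
  have V'c: "V' \<in> carrier_mat m (Suc r)" unfolding V'_def by simp
  note V'a = cadj_carrier[OF V'c]
  have V'V': "cadj V' * V' = 1\<^sub>m (Suc r)"
  proof (rule eq_matI)
    fix i j assume "i < dim_row (1\<^sub>m (Suc r))" "j < dim_col (1\<^sub>m (Suc r))"
    then have ij: "i < Suc r" "j < Suc r" by auto
    have "(cadj V' * V') $$ (i, j) = (\<Sum>t<m. cnj (V' $$ (t, i)) * V' $$ (t, j))"
      unfolding mult_index[OF V'a V'c ij] using V'c ij by (intro sum.cong) auto
    also have "\<dots> = (if i = j then 1 else 0)"
    proof -
      have vv: "(\<Sum>t<m. cnj (V $$ (t, i)) * V $$ (t, j)) = (if i = j then 1 else 0)" if "i < r" "j < r"
      proof -
        have "(\<Sum>t<m. cnj (V $$ (t, i)) * V $$ (t, j)) = (cadj V * V) $$ (i, j)"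
          unfolding mult_index[OF Va Vc that] using Vc that by (intro sum.cong) auto
        then show ?thesis using VV that by simp
      qed
      have yv: "(\<Sum>t<m. cnj (y $ t) * V $$ (t, j)) = 0" if "j < r"
      proof -
        have "(\<Sum>t<m. cnj (y $ t) * V $$ (t, j)) = cnj (\<Sum>t<m. cnj (V $$ (t, j)) * y $ t)"
          by (simp add: mult.commute)
        then show ?thesis using Vy that by simp
      qed
      have e: "V' $$ (t, i) = (if i < r then V $$ (t, i) else y $ t)"
        "V' $$ (t, j) = (if j < r then V $$ (t, j) else y $ t)" if "t < m" for t
        using ij that unfolding V'_def by auto
      have "(\<Sum>t<m. cnj (V' $$ (t, i)) * V' $$ (t, j)) = (\<Sum>t<m. cnj (if i < r then V $$ (t, i) else y $ t) * (if j < r then V $$ (t, j) else y $ t))"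
        by (rule sum.cong) (auto simp: e)
      also have "\<dots> = (if i = j then 1 else 0)"
        using ij vv yv yy Vy by (cases "i < r"; cases "j < r") auto
      finally show ?thesis .
    qed
    finally show "(cadj V' * V') $$ (i, j) = 1\<^sub>m (Suc r) $$ (i, j)" using ij by simp
  qed (use V'c V'a in auto)
  have "V' *\<^sub>v u \<in> K" if u: "u \<in> carrier_vec (Suc r)" for u
  proof -
    define u' where "u' = vec r (\<lambda>i. u $ i)"
    have u'c: "u' \<in> carrier_vec r" unfolding u'_def by simp
    have "V' *\<^sub>v u = V *\<^sub>v u' + (u $ r) \<cdot>\<^sub>v y"
    proof (rule eq_vecI)
      fix i assume "i < dim_vec (V *\<^sub>v u' + (u $ r) \<cdot>\<^sub>v y)"
      then have i: "i < m" using yc by auto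
      show "(V' *\<^sub>v u) $ i = (V *\<^sub>v u' + (u $ r) \<cdot>\<^sub>v y) $ i"
        using i yc Vc unfolding mult_vec_index[OF V'c u i]
        by (simp add: mult_vec_index[OF Vc u'c i] del: index_mult_mat_vec) (simp add: V'_def u'_def mult.commute)
    qed (use V'c yc in auto)
    then show ?thesis using Kd(3)[OF VK[OF u'c] Kd(4)[OF yK]] by simp
  qed
  then show ?thesis using V'c V'V' unfolding isometry_into_def by blast
qed

text \<open>The dimension of \<open>K\<close>, taken as the largest size of an orthonormal family in
  it.\<close>

definition cdim :: "nat \<Rightarrow> complex vec set \<Rightarrow> nat" where
  "cdim m K = Max {r. \<exists>V. isometry_into m r K V}"

lemma cdim_props:
  assumes "csubspace m K"
  shows "\<exists>V. isometry_into m (cdim m K) K V" and "isometry_into m r K V \<Longrightarrow> r \<le> cdim m K"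
proof -
  let ?S = "{r. \<exists>V. isometry_into m r K V}"
  have fin: "finite ?S"
    by (rule finite_subset[of _ "{..m}"]) (auto dest: isometry_into_le)
  \<comment> \<open>The empty family ensures that the maximum is taken over a nonempty set.\<close>
  have "isometry_into m 0 K (0\<^sub>m m 0)"
  proof -
    have "0\<^sub>m m 0 *\<^sub>v u = 0\<^sub>v m" if "u \<in> carrier_vec 0" for u :: "complex vec"
      using that by (intro eq_vecI) (auto simp: scalar_prod_def)
    then show ?thesis using csubspaceD(2)[OF assms]
      unfolding isometry_into_def by (auto simp: cadj_def)
  qed
  then have ne: "?S \<noteq> {}" by blast
  show "\<exists>V. isometry_into m (cdim m K) K V" using Max_in[OF fin ne] unfolding cdim_def by auto
  show "isometry_into m r K V \<Longrightarrow> r \<le> cdim m K" using Max_ge[OF fin] unfolding cdim_def by auto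
qed

text \<open>A family of maximal size admits no Gram-Schmidt step, so no vector of \<open>K\<close>
  has a nonzero residual: \<open>V * cadj V\<close> fixes \<open>K\<close> pointwise.\<close>

lemma maximal_isometry:
  assumes "csubspace m K" "isometry_into m r K V" "cdim m K \<le> r" "v \<in> K"
  shows "V *\<^sub>v (cadj V *\<^sub>v v) = v"
  using isometry_into_extend[OF assms(1,2,4)] cdim_props(2)[OF assms(1)] assms(3)
  by (meson not_less_eq_eq order_trans)

text \<open>If the dimensions agreed, a maximal family of \<open>K\<close> would also be maximal in
  \<open>L\<close>. Its projection would then fix \<open>L\<close> while taking values in
  \<open>K\<close>.\<close>

lemma cdim_strict_mono:
  assumes "csubspace m K" "csubspace m L" "K \<subset> L"
  shows "cdim m K < cdim m L"
proof (rule ccontr)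
  assume "\<not> cdim m K < cdim m L"
  then have le: "cdim m L \<le> cdim m K" by simp
  from cdim_props(1)[OF assms(1)] obtain V where V: "isometry_into m (cdim m K) K V" by auto
  then have VL: "isometry_into m (cdim m K) L V" using assms(3) unfolding isometry_into_def by auto
  have "v \<in> K" if "v \<in> L" for v
  proof -
    have "cadj V *\<^sub>v v \<in> carrier_vec (cdim m K)"
      using V csubspaceD(1)[OF assms(2) that] cadj_carrier unfolding isometry_into_def
      by (meson mult_mat_vec_carrier)
    then show ?thesis
      using maximal_isometry[OF assms(2) VL le that] V unfolding isometry_into_def by metis
  qed
  then show False using assms(3) by auto
qed

lemma subspace_isometry:
  assumes "csubspace m K"
  obtains r V where "V \<in> carrier_mat m r" "cadj V * V = 1\<^sub>m r" "\<And>u. u \<in> carrier_vec r \<Longrightarrow> V *\<^sub>v u \<in> K"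
    "\<And>v. v \<in> K \<Longrightarrow> V *\<^sub>v (cadj V *\<^sub>v v) = v"
  using cdim_props(1)[OF assms] maximal_isometry[OF assms] unfolding isometry_into_def by blast

section \<open>Burnside's theorem\<close>

lemma mult_mat_zero_vec: "A \<in> carrier_mat n k \<Longrightarrow> A *\<^sub>v 0\<^sub>v k = 0\<^sub>v n"
  by (intro eq_vecI) auto

lemma nonzero_mat_entry:
  assumes "A \<in> carrier_mat n k" "A \<noteq> 0\<^sub>m n k"
  shows "\<exists>i<n. \<exists>j<k. A $$ (i, j) \<noteq> 0"
proof (rule ccontr)
  assume "\<not> ?thesis"
  then have "A = 0\<^sub>m n k" using assms(1) by (intro eq_matI) auto
  then show False using assms(2) by simp
qed

definition mat_range :: "nat \<Rightarrow> complex mat \<Rightarrow> complex vec set" where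
  "mat_range m T = {T *\<^sub>v v | v. v \<in> carrier_vec m}"

lemma csubspace_mat_range:
  assumes T: "T \<in> carrier_mat m m"
  shows "csubspace m (mat_range m T)"
proof (rule csubspaceI)
  show "mat_range m T \<subseteq> carrier_vec m" using T unfolding mat_range_def by auto
  show "0\<^sub>v m \<in> mat_range m T" using T unfolding mat_range_def by (auto intro!: exI[of _ "0\<^sub>v m"])
  fix v w c
  assume "v \<in> mat_range m T"
  then obtain a where a: "v = T *\<^sub>v a" "a \<in> carrier_vec m" unfolding mat_range_def by auto
  show "c \<cdot>\<^sub>v v \<in> mat_range m T"
    unfolding mat_range_def a(1) using a(2) mult_mat_vec[OF T a(2), of c] by (auto intro!: exI[of _ "c \<cdot>\<^sub>v a"])
  assume "w \<in> mat_range m T"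
  then obtain b where b: "w = T *\<^sub>v b" "b \<in> carrier_vec m" unfolding mat_range_def by auto
  show "v + w \<in> mat_range m T"
    unfolding mat_range_def a(1) b(1) using a(2) b(2) mult_add_distrib_mat_vec[OF T a(2) b(2)]
    by (auto intro!: exI[of _ "a + b"])
qed

text \<open>The witness is an eigenvector of the compression of the adjoint of \<open>B\<close> to \<open>W\<close>.\<close>
lemma left_eigenvector_in_subspace:
  assumes W: "csubspace m W" and w: "w \<in> W" "w \<noteq> 0\<^sub>v m" and B: "B \<in> carrier_mat m m"
  obtains \<nu> z where "z \<in> W" "z \<noteq> 0\<^sub>v m" "\<And>w. w \<in> W \<Longrightarrow> (B *\<^sub>v w - \<nu> \<cdot>\<^sub>v w) \<bullet>c z = 0"
proof -
  obtain r V where V: "V \<in> carrier_mat m r" "cadj V * V = 1\<^sub>m r"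
    and VW: "\<And>u. u \<in> carrier_vec r \<Longrightarrow> V *\<^sub>v u \<in> W"
    and Vw: "\<And>v. v \<in> W \<Longrightarrow> V *\<^sub>v (cadj V *\<^sub>v v) = v"
    using subspace_isometry[OF W] by metis
  note Va = cadj_carrier[OF V(1)] and Ba = cadj_carrier[OF B]
  note Wc = csubspaceD(1)[OF W]
  \<comment> \<open>The spectrum is nonempty only for matrices of positive size; for
    \<open>r = 0\<close> the projection \<open>V * cadj V\<close> would send \<open>w\<close> to
    zero.\<close>
  have r: "r > 0"
  proof (rule ccontr)
    assume "\<not> r > 0"
    then have "V *\<^sub>v (cadj V *\<^sub>v w) = 0\<^sub>v m" using V Va by (intro eq_vecI) (auto simp: scalar_prod_def)
    then show False using Vw w by auto
  qed
  define N where "N = cadj V * (cadj B * V)"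
  have BV: "cadj B * V \<in> carrier_mat m r" using Ba V by simp
  have N: "N \<in> carrier_mat r r" unfolding N_def using Va BV by simp
  from spectrum_non_empty[OF N r] obtain \<mu> u where "eigenvector N u \<mu>"
    unfolding spectrum_def eigenvalue_def by auto
  then have u: "u \<in> carrier_vec r" "u \<noteq> 0\<^sub>v r" "N *\<^sub>v u = \<mu> \<cdot>\<^sub>v u"
    using N unfolding eigenvector_def by auto
  define z where "z = V *\<^sub>v u"
  have zW: "z \<in> W" unfolding z_def using VW u by auto
  have zc: "z \<in> carrier_vec m" using Wc zW by auto
  have "cadj V *\<^sub>v z = u"
    unfolding z_def using assoc_mult_mat_vec[OF Va V(1) u(1)] V(2) u by simp
  then have z0: "z \<noteq> 0\<^sub>v m" using u(2) Va mult_mat_zero_vec[OF Va] by auto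
  \<comment> \<open>The scalar is conjugated because \<open>\<mu>\<close> is an eigenvalue of the
    compressed adjoint and the inner product is conjugate linear in its second argument.\<close>
  have "(B *\<^sub>v w - cnj \<mu> \<cdot>\<^sub>v w) \<bullet>c z = 0" if "w \<in> W" for w
  proof -
    have wc: "w \<in> carrier_vec m" using Wc that by auto
    define x where "x = cadj V *\<^sub>v w"
    have x: "x \<in> carrier_vec r" "w = V *\<^sub>v x" unfolding x_def using Va wc Vw[OF that] by auto
    have Bz: "cadj B *\<^sub>v z \<in> carrier_vec m" using Ba zc by simp
    have "(B *\<^sub>v w) \<bullet>c z = w \<bullet>c (cadj B *\<^sub>v z)" by (rule cinner_cadj[OF B wc zc])
    also have "\<dots> = x \<bullet>c (cadj V *\<^sub>v (cadj B *\<^sub>v z))"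
      unfolding x(2) by (rule cinner_cadj[OF V(1) x(1) Bz])
    also have "cadj V *\<^sub>v (cadj B *\<^sub>v z) = N *\<^sub>v u"
      unfolding z_def N_def assoc_mult_mat_vec[OF Va BV u(1)] assoc_mult_mat_vec[OF Ba V(1) u(1)] ..
    also have "x \<bullet>c (N *\<^sub>v u) = cnj \<mu> * (x \<bullet>c u)"
      unfolding u(3) using u(1) x(1) by (simp add: cinner_eq[of _ r] sum_distrib_left algebra_simps)
    also have "x \<bullet>c u = w \<bullet>c z"
      unfolding x(2) cinner_cadj[OF V(1) x(1) zc] using \<open>cadj V *\<^sub>v z = u\<close> by simp
    finally have "(B *\<^sub>v w) \<bullet>c z = cnj \<mu> * (w \<bullet>c z)" .
    then show ?thesis
      using wc B unfolding cinner_eq[OF zc]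
      by (simp add: algebra_simps sum_subtractf sum_distrib_left del: index_mult_mat_vec)
  qed
  then show ?thesis using that zW z0 by blast
qed

text \<open>Following Lomonosov and Rosenthal: if \<open>T\<close> is a nonzero element of least rank and \<open>S\<close> is in the
  algebra, then \<open>T S T - \<nu> T\<close> has smaller rank for a suitable \<open>\<nu>\<close>, hence vanishes; by transitivity
  of the algebra this forces \<open>T\<close> to have rank one.\<close>
theorem burnside:
  assumes m: "m > 0" and G: "G \<subseteq> carrier_mat m m" "1\<^sub>m m \<in> G"
    and add: "\<And>A B. A \<in> G \<Longrightarrow> B \<in> G \<Longrightarrow> A + B \<in> G"
    and mult: "\<And>A B. A \<in> G \<Longrightarrow> B \<in> G \<Longrightarrow> A * B \<in> G"
    and smult: "\<And>c A. A \<in> G \<Longrightarrow> c \<cdot>\<^sub>m A \<in> G"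
    and irr: "\<And>K. csubspace m K \<Longrightarrow> (\<And>A v. A \<in> G \<Longrightarrow> v \<in> K \<Longrightarrow> A *\<^sub>v v \<in> K) \<Longrightarrow>
      K = {0\<^sub>v m} \<or> K = carrier_vec m"
  shows "G = carrier_mat m m"
proof -
  have Gc: "A \<in> carrier_mat m m" if "A \<in> G" for A using G that by auto
  have smult_vec: "(c \<cdot>\<^sub>m A) *\<^sub>v v = c \<cdot>\<^sub>v (A *\<^sub>v v)" if "A \<in> G" "v \<in> carrier_vec m" for c A v
    using Gc[OF that(1)] that(2) by (intro eq_vecI) auto
  have zeroG: "0\<^sub>m m m \<in> G"
  proof -
    have "0 \<cdot>\<^sub>m 1\<^sub>m m = (0\<^sub>m m m :: complex mat)" by (intro eq_matI) auto
    then show ?thesis using smult[OF G(2), of 0] by simp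
  qed
  \<comment> \<open>Transitivity: the orbit of \<open>y\<close> under \<open>G\<close> is an
    invariant subspace containing \<open>y\<close>, hence everything.\<close>
  have trans: "\<exists>A\<in>G. A *\<^sub>v y = x" if y: "y \<in> carrier_vec m" "y \<noteq> 0\<^sub>v m" and x: "x \<in> carrier_vec m" for x y
  proof -
    let ?K = "{A *\<^sub>v y | A. A \<in> G}"
    have "csubspace m ?K"
    proof (rule csubspaceI)
      show "?K \<subseteq> carrier_vec m" using Gc y by (auto intro!: mult_mat_vec_carrier)
      show "0\<^sub>v m \<in> ?K" using zeroG y by (auto intro!: exI[of _ "0\<^sub>m m m"])
      fix v w c
      assume "v \<in> ?K"
      then obtain A where A: "v = A *\<^sub>v y" "A \<in> G" by auto
      show "c \<cdot>\<^sub>v v \<in> ?K" using smult_vec[OF A(2) y(1)] smult[OF A(2)] A by (auto intro!: exI[of _ "c \<cdot>\<^sub>m A"])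
      assume "w \<in> ?K"
      then obtain B where B: "w = B *\<^sub>v y" "B \<in> G" by auto
      show "v + w \<in> ?K"
        using add_mult_distrib_mat_vec[OF Gc[OF A(2)] Gc[OF B(2)] y(1)] A B add by (auto intro!: exI[of _ "A + B"])
    qed
    moreover have "A *\<^sub>v v \<in> ?K" if "A \<in> G" "v \<in> ?K" for A v
    proof -
      from that(2) obtain B where B: "v = B *\<^sub>v y" "B \<in> G" by auto
      then have "A *\<^sub>v v = (A * B) *\<^sub>v y" using assoc_mult_mat_vec[OF Gc[OF that(1)] Gc[OF B(2)] y(1)] by simp
      then show ?thesis using mult[OF that(1) B(2)] by auto
    qed
    ultimately have "?K = {0\<^sub>v m} \<or> ?K = carrier_vec m" by (rule irr)
    moreover have "y \<in> ?K" using G(2) y(1) by (auto intro!: exI[of _ "1\<^sub>m m"])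
    ultimately have "?K = carrier_vec m" using y(2) by auto
    then have "x \<in> ?K" using x by simp
    then show ?thesis by auto
  qed
  define d where "d T = cdim m (mat_range m T)" for T
  have "1\<^sub>m m \<noteq> (0\<^sub>m m m :: complex mat)"
  proof
    assume "1\<^sub>m m = (0\<^sub>m m m :: complex mat)"
    then have "1\<^sub>m m $$ (0, 0) = (0\<^sub>m m m :: complex mat) $$ (0, 0)" by simp
    then show False using m by simp
  qed
  then have "\<exists>T. T \<in> G \<and> T \<noteq> 0\<^sub>m m m" using G by auto
  from ex_has_least_nat[of "\<lambda>T. T \<in> G \<and> T \<noteq> 0\<^sub>m m m" _ d] this
  obtain T where T: "T \<in> G" "T \<noteq> 0\<^sub>m m m"
    and Tmin: "\<And>S. S \<in> G \<Longrightarrow> S \<noteq> 0\<^sub>m m m \<Longrightarrow> d T \<le> d S" by blast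
  note Tc = Gc[OF T(1)]
  define W where "W = mat_range m T"
  have W: "csubspace m W" unfolding W_def by (rule csubspace_mat_range[OF Tc])
  obtain i0 j0 where ij0: "i0 < m" "j0 < m" "T $$ (i0, j0) \<noteq> 0"
    using nonzero_mat_entry[OF Tc T(2)] by blast
  define y where "y = T *\<^sub>v unit_vec m j0"
  have yc: "y \<in> carrier_vec m" unfolding y_def using Tc by simp
  have yi: "y $ i = T $$ (i, j0)" if "i < m" for i
    unfolding y_def using Tc that ij0 by simp
  have y0: "y \<noteq> 0\<^sub>v m" using yi[OF ij0(1)] ij0 by auto
  have yW: "y \<in> W" unfolding y_def W_def mat_range_def by auto
  have rank1: "\<exists>c. T *\<^sub>v x = c \<cdot>\<^sub>v y" if x: "x \<in> carrier_vec m" for x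
  proof -
    \<comment> \<open>With \<open>S y = x\<close>, the vanishing of
      \<open>T' = T S T - \<nu> T\<close>, evaluated at the unit vector that \<open>T\<close> sends
      to \<open>y\<close>, reads \<open>T x = \<nu> y\<close>.\<close>
    from trans[OF yc y0 x] obtain S where S: "S \<in> G" "S *\<^sub>v y = x" by auto
    define B where "B = T * S"
    have B: "B \<in> G" unfolding B_def using mult T S by auto
    obtain \<nu> z where z: "z \<in> W" "z \<noteq> 0\<^sub>v m" and orth: "\<And>w. w \<in> W \<Longrightarrow> (B *\<^sub>v w - \<nu> \<cdot>\<^sub>v w) \<bullet>c z = 0"
      using left_eigenvector_in_subspace[OF W yW y0 Gc[OF B]] by metis
    define T' where "T' = B * T + (- \<nu>) \<cdot>\<^sub>m T"
    have T': "T' \<in> G" unfolding T'_def using add mult smult B T by auto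
    have T'v: "T' *\<^sub>v v = B *\<^sub>v (T *\<^sub>v v) - \<nu> \<cdot>\<^sub>v (T *\<^sub>v v)" if v: "v \<in> carrier_vec m" for v
    proof -
      have "T' *\<^sub>v v = B *\<^sub>v (T *\<^sub>v v) + (- \<nu>) \<cdot>\<^sub>v (T *\<^sub>v v)"
        unfolding T'_def add_mult_distrib_mat_vec[OF Gc[OF mult[OF B T(1)]] Gc[OF smult[OF T(1)]] v]
          assoc_mult_mat_vec[OF Gc[OF B] Tc v] smult_vec[OF T(1) v] ..
      also have "\<dots> = B *\<^sub>v (T *\<^sub>v v) - \<nu> \<cdot>\<^sub>v (T *\<^sub>v v)"
        using Gc[OF B] Tc by (intro eq_vecI) auto
      finally show ?thesis .
    qed
    have sub: "mat_range m T' \<subseteq> W"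
    proof
      fix q assume "q \<in> mat_range m T'"
      then obtain v where v: "q = T' *\<^sub>v v" "v \<in> carrier_vec m" unfolding mat_range_def by auto
      have Sv: "S *\<^sub>v (T *\<^sub>v v) \<in> carrier_vec m" using Gc[OF S(1)] Tc v by simp
      have "B *\<^sub>v (T *\<^sub>v v) = T *\<^sub>v (S *\<^sub>v (T *\<^sub>v v))"
        unfolding B_def using assoc_mult_mat_vec[OF Tc Gc[OF S(1)]] Tc v by simp
      then have "B *\<^sub>v (T *\<^sub>v v) \<in> W" using Sv unfolding W_def mat_range_def by auto
      moreover have "T *\<^sub>v v \<in> W" using v unfolding W_def mat_range_def by auto
      ultimately show "q \<in> W" unfolding v(1) T'v[OF v(2)] using csubspaceD(4,5)[OF W] by blast
    qed
    \<comment> \<open>The range of \<open>T'\<close> is orthogonal to \<open>z\<close>, which is a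
      nonzero element of \<open>W\<close>. So this range is a proper subspace of \<open>W\<close>,
      and minimality of \<open>T\<close> applies.\<close>
    have "z \<notin> mat_range m T'"
    proof
      assume "z \<in> mat_range m T'"
      then obtain v where v: "z = T' *\<^sub>v v" "v \<in> carrier_vec m" unfolding mat_range_def by auto
      have "T *\<^sub>v v \<in> W" using v unfolding W_def mat_range_def by auto
      from orth[OF this] have "z \<bullet>c z = 0" using T'v[OF v(2)] v(1) by simp
      then show False using cinner_self_zero csubspaceD(1)[OF W z(1)] z(2) by blast
    qed
    with sub z have "mat_range m T' \<subset> W" by auto
    then have "d T' < d T"
      unfolding d_def using cdim_strict_mono[OF csubspace_mat_range[OF Gc[OF T']] W] by (simp add: W_def)
    then have T'0: "T' = 0\<^sub>m m m" using Tmin[OF T'] by fastforce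
    have "T *\<^sub>v x = B *\<^sub>v y" unfolding B_def using assoc_mult_mat_vec[OF Tc Gc[OF S(1)] yc] S by simp
    moreover have "0\<^sub>m m m *\<^sub>v unit_vec m j0 = (0\<^sub>v m :: complex vec)"
      by (intro eq_vecI) (auto simp: scalar_prod_def)
    then have "B *\<^sub>v y - \<nu> \<cdot>\<^sub>v y = 0\<^sub>v m"
      using T'v[of "unit_vec m j0"] unfolding T'0 y_def[symmetric] by simp
    then have "B *\<^sub>v y = \<nu> \<cdot>\<^sub>v y" using yc Gc[OF B] by (auto simp: vec_eq_iff)
    ultimately show ?thesis by auto
  qed
  have "\<forall>j. \<exists>c. T *\<^sub>v unit_vec m j = c \<cdot>\<^sub>v y" using rank1 by simp
  then obtain f' where f': "\<And>j. T *\<^sub>v unit_vec m j = f' j \<cdot>\<^sub>v y" by metis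
  have Tij: "T $$ (i, j) = y $ i * f' j" if "i < m" "j < m" for i j
  proof -
    have "T $$ (i, j) = (T *\<^sub>v unit_vec m j) $ i" using Tc that by simp
    then show ?thesis unfolding f' using that yc by simp
  qed
  define f where "f = vec m f'"
  have fc: "f \<in> carrier_vec m" unfolding f_def by simp
  have f0: "f $ j0 \<noteq> 0" using Tij[OF ij0(1,2)] ij0 unfolding f_def by auto
  \<comment> \<open>In this notation \<open>T\<close> is \<open>outer y f\<close>, and multiplying
    it from the left by \<open>A\<close> with \<open>A y = a\<close> gives
    \<open>outer a f\<close>.\<close>
  define outer where "outer a g = mat m m (\<lambda>(i, j). a $ i * g $ j)" for a g :: "complex vec"
  have outer_c: "outer a g \<in> carrier_mat m m" for a g unfolding outer_def by simp
  have outer_f: "outer a f \<in> G" if a: "a \<in> carrier_vec m" for a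
  proof -
    from trans[OF yc y0 a] obtain A where A: "A \<in> G" "A *\<^sub>v y = a" by auto
    have "outer a f = A * T"
    proof (rule eq_matI)
      fix i j assume "i < dim_row (A * T)" "j < dim_col (A * T)"
      then have ij: "i < m" "j < m" using Gc[OF A(1)] Tc by auto
      have "(A * T) $$ (i, j) = (\<Sum>t<m. A $$ (i, t) * y $ t) * f $ j"
        unfolding mult_index[OF Gc[OF A(1)] Tc ij] sum_distrib_right
        using ij by (intro sum.cong) (auto simp: Tij f_def)
      also have "(\<Sum>t<m. A $$ (i, t) * y $ t) = a $ i"
        using mult_vec_index[OF Gc[OF A(1)] yc ij(1)] A(2) by simp
      finally show "outer a f $$ (i, j) = (A * T) $$ (i, j)" unfolding outer_def using ij by simp
    qed (use Gc[OF A(1)] Tc in \<open>auto simp: outer_def\<close>)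
    then show ?thesis using mult[OF A(1) T(1)] by simp
  qed
  \<comment> \<open>The rows \<open>f A\<close> for \<open>A\<close> in \<open>G\<close>. Once they
    fill the space, the products \<open>outer a f * A\<close> exhaust all outer products.\<close>
  define R where "R = {vec m (\<lambda>j. \<Sum>t<m. f $ t * A $$ (t, j)) | A. A \<in> G}"
  have R: "csubspace m R"
  proof (rule csubspaceI)
    show "R \<subseteq> carrier_vec m" unfolding R_def by auto
    show "0\<^sub>v m \<in> R" unfolding R_def using zeroG
      by (auto intro!: exI[of _ "0\<^sub>m m m"] eq_vecI)
    fix v w c
    assume "v \<in> R"
    then obtain A where A: "v = vec m (\<lambda>j. \<Sum>t<m. f $ t * A $$ (t, j))" "A \<in> G" unfolding R_def by auto
    show "c \<cdot>\<^sub>v v \<in> R" unfolding R_def using smult[OF A(2), of c] Gc[OF A(2)] A(1)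
      by (auto intro!: exI[of _ "c \<cdot>\<^sub>m A"] eq_vecI simp: sum_distrib_left algebra_simps)
    assume "w \<in> R"
    then obtain B where B: "w = vec m (\<lambda>j. \<Sum>t<m. f $ t * B $$ (t, j))" "B \<in> G" unfolding R_def by auto
    show "v + w \<in> R" unfolding R_def using add[OF A(2) B(2)] Gc[OF A(2)] Gc[OF B(2)] A(1) B(1)
      by (auto intro!: exI[of _ "A + B"] eq_vecI simp: sum.distrib algebra_simps)
  qed
  \<comment> \<open>The vectors killed by all rows in \<open>R\<close>. Closure of \<open>G\<close>
    under products makes this subspace invariant, and \<open>f\<close> itself, as the row of the
    identity, keeps it from being everything.\<close>
  define Z where "Z = {v \<in> carrier_vec m. \<forall>A\<in>G. (\<Sum>t<m. f $ t * (A *\<^sub>v v) $ t) = 0}"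
  have "csubspace m Z"
  proof (rule csubspaceI)
    show "Z \<subseteq> carrier_vec m" unfolding Z_def by auto
    show "0\<^sub>v m \<in> Z" unfolding Z_def using mult_mat_zero_vec[OF Gc] by simp
    fix v w c
    assume v: "v \<in> Z"
    have "(A *\<^sub>v (c \<cdot>\<^sub>v v)) $ t = c * (A *\<^sub>v v) $ t" if "A \<in> G" "t < m" for A t
      using mult_mat_vec[OF Gc[OF that(1)], of v c] v that Gc[OF that(1)] unfolding Z_def by simp
    then have "(\<Sum>t<m. f $ t * (A *\<^sub>v (c \<cdot>\<^sub>v v)) $ t) = c * (\<Sum>t<m. f $ t * (A *\<^sub>v v) $ t)" if "A \<in> G" for A
      using that unfolding sum_distrib_left by (intro sum.cong) auto
    then show "c \<cdot>\<^sub>v v \<in> Z" using v unfolding Z_def by simp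
    assume w: "w \<in> Z"
    have "(A *\<^sub>v (v + w)) $ t = (A *\<^sub>v v) $ t + (A *\<^sub>v w) $ t" if "A \<in> G" "t < m" for A t
      using mult_add_distrib_mat_vec[OF Gc[OF that(1)], of v w] v w that Gc[OF that(1)] unfolding Z_def by simp
    then have "(\<Sum>t<m. f $ t * (A *\<^sub>v (v + w)) $ t) = (\<Sum>t<m. f $ t * (A *\<^sub>v v) $ t) + (\<Sum>t<m. f $ t * (A *\<^sub>v w) $ t)"
      if "A \<in> G" for A
      using that unfolding sum.distrib[symmetric] by (intro sum.cong) (auto simp: algebra_simps)
    then show "v + w \<in> Z" using v w unfolding Z_def by simp
  qed
  moreover have "A *\<^sub>v v \<in> Z" if A: "A \<in> G" and v: "v \<in> Z" for A v
    unfolding Z_def mem_Collect_eq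
  proof (intro conjI ballI)
    have vc: "v \<in> carrier_vec m" using v unfolding Z_def by simp
    show "A *\<^sub>v v \<in> carrier_vec m" using Gc[OF A] vc by simp
    fix B assume B: "B \<in> G"
    have "B *\<^sub>v (A *\<^sub>v v) = (B * A) *\<^sub>v v" using assoc_mult_mat_vec[OF Gc[OF B] Gc[OF A] vc] by simp
    then show "(\<Sum>t<m. f $ t * (B *\<^sub>v (A *\<^sub>v v)) $ t) = 0" using v mult[OF B A] unfolding Z_def by simp
  qed
  ultimately have "Z = {0\<^sub>v m} \<or> Z = carrier_vec m" by (rule irr)
  moreover have "unit_vec m j0 \<notin> Z"
  proof
    assume "unit_vec m j0 \<in> Z"
    then have "(\<Sum>t<m. f $ t * (1\<^sub>m m *\<^sub>v unit_vec m j0) $ t) = 0" using G(2) unfolding Z_def by blast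
    moreover have "(\<Sum>t<m. f $ t * (1\<^sub>m m *\<^sub>v unit_vec m j0) $ t) = (\<Sum>t<m. if t = j0 then f $ j0 else 0)"
      by (rule sum.cong) (use ij0 in auto)
    ultimately show False using f0 ij0 by simp
  qed
  ultimately have Z0: "Z = {0\<^sub>v m}" by auto
  have R_all: "g \<in> R" if g: "g \<in> carrier_vec m" for g
  proof -
    obtain r V where V: "V \<in> carrier_mat m r" "cadj V * V = 1\<^sub>m r"
      and VR: "\<And>u. u \<in> carrier_vec r \<Longrightarrow> V *\<^sub>v u \<in> R"
      and Vv: "\<And>v. v \<in> R \<Longrightarrow> V *\<^sub>v (cadj V *\<^sub>v v) = v"
      using subspace_isometry[OF R] by metis
    note Va = cadj_carrier[OF V(1)]
    define x where "x = cadj V *\<^sub>v g"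
    have x: "x \<in> carrier_vec r" unfolding x_def using Va g by simp
    have Vx: "V *\<^sub>v x \<in> carrier_vec m" using V x by simp
    \<comment> \<open>The component of \<open>g\<close> orthogonal to \<open>R\<close>; it remains
      to see that it vanishes.\<close>
    define h where "h = g - V *\<^sub>v x"
    have h: "h \<in> carrier_vec m" unfolding h_def using Vx g by simp
    have "cadj V *\<^sub>v h = cadj V *\<^sub>v g - cadj V *\<^sub>v (V *\<^sub>v x)"
      unfolding h_def by (rule mult_minus_distrib_mat_vec[OF Va g Vx])
    also have "cadj V *\<^sub>v (V *\<^sub>v x) = x" using assoc_mult_mat_vec[OF Va V(1) x] V(2) x by simp
    finally have Vh: "cadj V *\<^sub>v h = 0\<^sub>v r" using x unfolding x_def by simp
    have orth: "w \<bullet>c h = 0" if "w \<in> R" for w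
    proof -
      have wc: "w \<in> carrier_vec m" using csubspaceD(1)[OF R that] .
      have "w \<bullet>c h = (V *\<^sub>v (cadj V *\<^sub>v w)) \<bullet>c h" using Vv[OF that] by simp
      also have "\<dots> = (cadj V *\<^sub>v w) \<bullet>c (cadj V *\<^sub>v h)"
        using Va wc by (intro cinner_cadj[OF V(1) _ h]) simp
      also have "\<dots> = 0" unfolding Vh by (auto simp: scalar_prod_def intro!: sum.neutral)
      finally show ?thesis .
    qed
    \<comment> \<open>\<open>Z\<close> pairs bilinearly with the rows in \<open>R\<close>, whereas
      orthogonality is sesquilinear; hence the conjugate.\<close>
    have "conjugate h \<in> Z"
      unfolding Z_def mem_Collect_eq
    proof (intro conjI ballI)
      show "conjugate h \<in> carrier_vec m" using h by simp
      fix A assume A: "A \<in> G"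
      have "(\<Sum>t<m. f $ t * (A *\<^sub>v conjugate h) $ t) = (\<Sum>t<m. \<Sum>j<m. f $ t * A $$ (t, j) * cnj (h $ j))"
        using h by (intro sum.cong) (auto simp: mult_vec_index[OF Gc[OF A]] sum_distrib_left algebra_simps simp del: index_mult_mat_vec)
      also have "\<dots> = (\<Sum>j<m. \<Sum>t<m. f $ t * A $$ (t, j) * cnj (h $ j))" by (rule sum.swap)
      also have "\<dots> = vec m (\<lambda>j. \<Sum>t<m. f $ t * A $$ (t, j)) \<bullet>c h"
        unfolding cinner_eq[OF h] by (intro sum.cong) (auto simp: sum_distrib_right)
      also have "\<dots> = 0" using orth A unfolding R_def by blast
      finally show "(\<Sum>t<m. f $ t * (A *\<^sub>v conjugate h) $ t) = 0" .
    qed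
    then have "conjugate h = 0\<^sub>v m" using Z0 by simp
    have h0: "h $ i = 0" if "i < m" for i
    proof -
      have "conjugate h $ i = 0" using \<open>conjugate h = 0\<^sub>v m\<close> that by simp
      then show ?thesis using that h by simp
    qed
    have "g = V *\<^sub>v x"
    proof (rule eq_vecI)
      fix i assume "i < dim_vec (V *\<^sub>v x)"
      then have "i < m" using V(1) by simp
      then show "g $ i = (V *\<^sub>v x) $ i"
        using h0[of i] g Vx V(1) unfolding h_def by (simp del: index_mult_mat_vec)
    qed (use g V(1) in auto)
    then show ?thesis using VR[OF x] by simp
  qed
  have outer_all: "outer a g \<in> G" if a: "a \<in> carrier_vec m" and g: "g \<in> carrier_vec m" for a g
  proof -
    from R_all[OF g] obtain A where A: "g = vec m (\<lambda>j. \<Sum>t<m. f $ t * A $$ (t, j))" "A \<in> G" unfolding R_def by auto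
    have "outer a g = outer a f * A"
    proof (rule eq_matI)
      fix i j assume "i < dim_row (outer a f * A)" "j < dim_col (outer a f * A)"
      then have ij: "i < m" "j < m" using Gc[OF A(2)] outer_c[of a f] by auto
      have "(outer a f * A) $$ (i, j) = (\<Sum>t<m. a $ i * (f $ t * A $$ (t, j)))"
        unfolding mult_index[OF outer_c Gc[OF A(2)] ij] using ij by (intro sum.cong) (auto simp: outer_def)
      also have "\<dots> = a $ i * g $ j" unfolding A(1) using ij by (simp add: sum_distrib_left)
      finally show "outer a g $$ (i, j) = (outer a f * A) $$ (i, j)" unfolding outer_def using ij by simp
    qed (use Gc[OF A(2)] in \<open>auto simp: outer_def\<close>)
    then show ?thesis using mult[OF outer_f[OF a] A(2)] by simp
  qed
  have "X \<in> G" if X: "X \<in> carrier_mat m m" for X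
  proof -
    \<comment> \<open>Builds \<open>X\<close> one column at a time, each column being an outer
      product with a coordinate row.\<close>
    have "mat m m (\<lambda>(i, j). if j < k then X $$ (i, j) else 0) \<in> G" for k
    proof (induction k)
      case 0
      have "mat m m (\<lambda>(i, j). if j < 0 then X $$ (i, j) else 0) = 0\<^sub>m m m" by (intro eq_matI) auto
      then show ?case using zeroG by (simp only:)
    next
      case (Suc k)
      have "mat m m (\<lambda>(i, j). if j < Suc k then X $$ (i, j) else 0) =
        mat m m (\<lambda>(i, j). if j < k then X $$ (i, j) else 0) + outer (vec m (\<lambda>i. X $$ (i, k))) (vec m (\<lambda>j. if j = k then 1 else 0))"
        by (intro eq_matI) (auto simp: outer_def less_Suc_eq)
      then show ?case using add[OF Suc outer_all] by simp
    qed
    from this[of m] have "mat m m (\<lambda>(i, j). if j < m then X $$ (i, j) else 0) \<in> G" .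
    moreover have "mat m m (\<lambda>(i, j). if j < m then X $$ (i, j) else 0) = X" using X by (intro eq_matI) auto
    ultimately show ?thesis by simp
  qed
  then show ?thesis using G by auto
qed

section \<open>Kraus decomposition\<close>

lemma blk_less: "i < sum_list ns \<Longrightarrow> blk ns i < length ns"
  by (induction ns i rule: blk.induct) auto

lemma blockalg_carrier: "X \<in> blockalg ns \<Longrightarrow> X \<in> carrier_mat (sum_list ns) (sum_list ns)"
  unfolding blockalg_def by auto

lemma blockalg_off_diag:
  "X \<in> blockalg ns \<Longrightarrow> i < sum_list ns \<Longrightarrow> j < sum_list ns \<Longrightarrow> blk ns i \<noteq> blk ns j \<Longrightarrow> X $$ (i, j) = 0"
  unfolding blockalg_def by auto

lemma bdiag_part_in_blockalg: "bdiag_part ns X \<in> blockalg ns"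
  unfolding bdiag_part_def blockalg_def by auto

lemma bdiag_part_id: "X \<in> blockalg ns \<Longrightarrow> bdiag_part ns X = X"
  unfolding bdiag_part_def blockalg_def by (intro eq_matI) auto

lemma one_in_blockalg: "1\<^sub>m (sum_list ns) \<in> blockalg ns"
  unfolding blockalg_def by auto

lemma mult_in_blockalg:
  assumes "X \<in> blockalg ns" "Y \<in> blockalg ns"
  shows "X * Y \<in> blockalg ns"
proof -
  note c = blockalg_carrier[OF assms(1)] blockalg_carrier[OF assms(2)]
  have "(X * Y) $$ (i, j) = 0" if "i < sum_list ns" "j < sum_list ns" "blk ns i \<noteq> blk ns j" for i j
    unfolding mult_index[OF c that(1,2)]
    by (rule sum.neutral) (use blockalg_off_diag[OF assms(1) that(1)] blockalg_off_diag[OF assms(2) _ that(2)] that(3) in force)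
  then show ?thesis using c unfolding blockalg_def by simp
qed

section \<open>Kraus sums in coordinates\<close>

lemma kraus_sum_Nil [simp]: "kraus_sum m [] X = 0\<^sub>m m m"
  and kraus_sum_Cons [simp]: "kraus_sum m (A # As) X = cadj A * X * A + kraus_sum m As X"
  unfolding kraus_sum_def by auto

lemma conj_carrier:
  assumes "A \<in> carrier_mat m m" "X \<in> carrier_mat m m"
  shows "cadj A * X * A \<in> carrier_mat m m"
  using cadj_carrier[OF assms(1)] assms by simp

lemma kraus_sum_carrier:
  "set As \<subseteq> carrier_mat m m \<Longrightarrow> X \<in> carrier_mat m m \<Longrightarrow> kraus_sum m As X \<in> carrier_mat m m"
  by (induction As) (auto simp: conj_carrier)

lemma conj_index:
  assumes A: "A \<in> carrier_mat m m" and X: "X \<in> carrier_mat m m" and ab: "a < m" "b < m"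
  shows "(cadj A * X * A) $$ (a, b) = (\<Sum>i<m. \<Sum>j<m. cnj (A $$ (i, a)) * X $$ (i, j) * A $$ (j, b))"
proof -
  note Aa = cadj_carrier[OF A]
  have AX: "cadj A * X \<in> carrier_mat m m" using Aa X by simp
  have "(cadj A * X * A) $$ (a, b) = (\<Sum>j<m. \<Sum>i<m. cnj (A $$ (i, a)) * X $$ (i, j) * A $$ (j, b))"
    unfolding mult_index[OF AX A ab]
  proof (rule sum.cong[OF refl])
    fix j assume "j \<in> {..<m}"
    then have j: "j < m" by simp
    show "(cadj A * X) $$ (a, j) * A $$ (j, b) = (\<Sum>i<m. cnj (A $$ (i, a)) * X $$ (i, j) * A $$ (j, b))"
      unfolding mult_index[OF Aa X ab(1) j] sum_distrib_right
      by (rule sum.cong) (use cadj_index[OF A ab(1)] in auto)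
  qed
  also have "\<dots> = (\<Sum>i<m. \<Sum>j<m. cnj (A $$ (i, a)) * X $$ (i, j) * A $$ (j, b))" by (rule sum.swap)
  finally show ?thesis .
qed

lemma kraus_sum_index:
  assumes "set As \<subseteq> carrier_mat m m" "X \<in> carrier_mat m m" "a < m" "b < m"
  shows "kraus_sum m As X $$ (a, b) =
    (\<Sum>A\<leftarrow>As. \<Sum>i<m. \<Sum>j<m. cnj (A $$ (i, a)) * X $$ (i, j) * A $$ (j, b))"
  using assms(1)
proof (induction As)
  case Nil
  then show ?case using assms by simp
next
  case (Cons A As)
  have c: "A \<in> carrier_mat m m" "set As \<subseteq> carrier_mat m m" using Cons.prems by auto
  show ?case
    using Cons.IH[OF c(2)] conj_index[OF c(1) assms(2-4)] kraus_sum_carrier[OF c(2) assms(2)] assms(3,4) by simp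
qed

lemma sum_list_sum_swap: "(\<Sum>x\<leftarrow>xs. \<Sum>i\<in>I. f x i) = (\<Sum>i\<in>I. \<Sum>x\<leftarrow>xs. (f x i :: complex))"
  by (induction xs) (auto simp: sum.distrib)

section \<open>The Choi matrix of the canonical extension\<close>

lemma psd_form_of_psd:
  assumes "psd N M"
  shows "psd_form {..<N} (\<lambda>p q. M $$ (p, q))"
  unfolding psd_form_def
proof
  fix v :: "nat \<Rightarrow> complex"
  have M: "M \<in> carrier_mat N N" using assms unfolding psd_def by simp
  have "(\<Sum>i<N. cnj (vec N v $ i) * (M *\<^sub>v vec N v) $ i) = (\<Sum>i<N. \<Sum>j<N. cnj (v i) * M $$ (i, j) * v j)"
    by (rule sum.cong) (auto simp: mult_vec_index[OF M] sum_distrib_left mult.assoc simp del: index_mult_mat_vec)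
  moreover have "vec N v \<in> carrier_vec N" by simp
  ultimately show "(\<Sum>i<N. \<Sum>j<N. cnj (v i) * M $$ (i, j) * v j) \<in> \<real> \<and>
     0 \<le> Re (\<Sum>i<N. \<Sum>j<N. cnj (v i) * M $$ (i, j) * v j)"
    using assms unfolding psd_def by metis
qed

text \<open>The matrix unit at \<open>(i, j)\<close> if both indices lie in one block, and zero
  otherwise. Cutting it this way keeps it in the block algebra, where complete positivity of
  \<open>\<tau>\<close> can be applied.\<close>

definition bunit :: "nat list \<Rightarrow> nat \<Rightarrow> nat \<Rightarrow> complex mat" where
  "bunit ns i j = bdiag_part ns (mat (sum_list ns) (sum_list ns) (\<lambda>(r, s). if r = i \<and> s = j then 1 else 0))"

lemma bunit_in_blockalg: "bunit ns i j \<in> blockalg ns"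
  unfolding bunit_def by (rule bdiag_part_in_blockalg)

text \<open>The assembled matrix is a sum of one rank-one projection multiple per block: with
  \<open>u_k\<close> the sum of \<open>e_i \<otimes> e_i\<close> over the indices \<open>i\<close>
  of block \<open>k\<close>, it is the sum of the matrices \<open>u_k * cadj u_k\<close>. The
  quadratic form is thus a sum of squared moduli.\<close>

lemma psd_assemble_bunit:
  fixes ns :: "nat list"
  defines "m \<equiv> sum_list ns"
  shows "psd (m * m) (assemble m m (bunit ns))"
  unfolding psd_def
proof (intro conjI ballI)
  let ?M = "assemble m m (bunit ns)"
  show M: "?M \<in> carrier_mat (m * m) (m * m)" unfolding assemble_def by simp
  fix v :: "complex vec" assume v: "v \<in> carrier_vec (m * m)"
  \<comment> \<open>Position \<open>p\<close> encodes the pair \<open>(p div m, p mod m)\<close>;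
    \<open>\<delta>\<close> picks the diagonal pairs, \<open>b\<close> is the block of the first
    component, and \<open>x k\<close> pairs \<open>v\<close> with the vector of block
    \<open>k\<close>.\<close>
  define \<delta> where "\<delta> p \<longleftrightarrow> p mod m = p div m" for p
  define b where "b p = blk ns (p div m)" for p
  define x where "x k = (\<Sum>p<m * m. if \<delta> p \<and> b p = k then v $ p else 0)" for k
  let ?L = "length ns"
  have dm: "p div m < m" "p mod m < m" if "p < m * m" for p
    using that by (auto simp: less_mult_imp_div_less) (metis gr_zeroI mod_less_divisor mult_0 not_less_zero)
  have bL: "b p < ?L" if "p < m * m" for p
    using blk_less[of "p div m" ns] dm[OF that] unfolding b_def m_def by simp
  have Mpq: "?M $$ (p, q) = (if \<delta> p \<and> \<delta> q \<and> b p = b q then 1 else 0)" if "p < m * m" "q < m * m" for p q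
    using that dm[OF that(1)] dm[OF that(2)] unfolding assemble_def bunit_def bdiag_part_def m_def[symmetric] \<delta>_def b_def
    by auto
  have "(\<Sum>p<m * m. cnj (v $ p) * (?M *\<^sub>v v) $ p) = (\<Sum>p<m * m. \<Sum>q<m * m. cnj (v $ p) * ?M $$ (p, q) * v $ q)"
    by (rule sum.cong) (auto simp: mult_vec_index[OF M v] sum_distrib_left mult.assoc simp del: index_mult_mat_vec)
  also have "\<dots> = (\<Sum>p<m * m. \<Sum>q<m * m. \<Sum>k<?L.
      cnj (if \<delta> p \<and> b p = k then v $ p else 0) * (if \<delta> q \<and> b q = k then v $ q else 0))"
  proof (intro sum.cong refl)
    fix p q assume "p \<in> {..<m * m}" "q \<in> {..<m * m}"
    then have pq: "p < m * m" "q < m * m" by auto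
    have "(\<Sum>k<?L. cnj (if \<delta> p \<and> b p = k then v $ p else 0) * (if \<delta> q \<and> b q = k then v $ q else 0))
      = (\<Sum>k<?L. if b p = k then (if \<delta> p \<and> \<delta> q \<and> b p = b q then cnj (v $ p) * v $ q else 0) else 0)"
      by (rule sum.cong) auto
    also have "\<dots> = (if \<delta> p \<and> \<delta> q \<and> b p = b q then cnj (v $ p) * v $ q else 0)"
      using bL[OF pq(1)] by simp
    finally show "cnj (v $ p) * ?M $$ (p, q) * v $ q =
      (\<Sum>k<?L. cnj (if \<delta> p \<and> b p = k then v $ p else 0) * (if \<delta> q \<and> b q = k then v $ q else 0))"
      unfolding Mpq[OF pq] by simp
  qed
  also have "\<dots> = (\<Sum>k<?L. \<Sum>p<m * m. \<Sum>q<m * m.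
      cnj (if \<delta> p \<and> b p = k then v $ p else 0) * (if \<delta> q \<and> b q = k then v $ q else 0))"
    by (subst sum.swap, subst (2) sum.swap, subst sum.swap) (rule sum.cong[OF refl], rule sum.swap)
  also have "\<dots> = (\<Sum>k<?L. cnj (x k) * x k)"
    unfolding x_def cnj_sum sum_product ..
  also have "\<dots> = of_real (\<Sum>k<?L. (cmod (x k))\<^sup>2)"
    unfolding of_real_sum complex_norm_square by (simp add: mult.commute)
  finally have eq: "(\<Sum>p<m * m. cnj (v $ p) * (?M *\<^sub>v v) $ p) = of_real (\<Sum>k<?L. (cmod (x k))\<^sup>2)" .
  show "(\<Sum>p<m * m. cnj (v $ p) * (?M *\<^sub>v v) $ p) \<in> \<real>" unfolding eq by simp
  show "0 \<le> Re (\<Sum>p<m * m. cnj (v $ p) * (?M *\<^sub>v v) $ p)"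
    unfolding eq Re_complex_of_real by (simp add: sum_nonneg)
qed

lemma canon_ext_expand:
  fixes ns :: "nat list"
  defines "m \<equiv> sum_list ns"
  assumes lin: "lin_on (blockalg ns) \<tau>" and X: "X \<in> carrier_mat m m" and ab: "a < m" "b < m"
  shows "canon_ext ns \<tau> X $$ (a, b) = (\<Sum>i<m. \<Sum>j<m. X $$ (i, j) * \<tau> (bunit ns i j) $$ (a, b))"
proof -
  \<comment> \<open>\<open>X\<close> truncated to the positions in \<open>S\<close>. Adding one
    position at a time reduces linear expansion to the two rules in \<open>lin_on\<close>.\<close>
  define R where "R S = mat m m (\<lambda>(r, s). if (r, s) \<in> S then X $$ (r, s) else 0)" for S
  have \<tau>c: "\<tau> Y \<in> carrier_mat m m" if "Y \<in> blockalg ns" for Y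
    using lin that blockalg_carrier unfolding lin_on_def m_def by blast
  have "canon_ext ns \<tau> (R S) $$ (a, b) = (\<Sum>(i, j)\<in>S. X $$ (i, j) * \<tau> (bunit ns i j) $$ (a, b))"
    if "finite S" "S \<subseteq> {..<m} \<times> {..<m}" for S
    using that
  proof (induction S rule: finite_induct)
    case empty
    \<comment> \<open>The zero matrix is written as a multiple of an element of the block algebra,
      so that homogeneity yields the value zero.\<close>
    have "bdiag_part ns (R {}) = 0 \<cdot>\<^sub>m bunit ns 0 0"
      unfolding R_def bunit_def bdiag_part_def m_def by (intro eq_matI) auto
    then have "canon_ext ns \<tau> (R {}) = 0 \<cdot>\<^sub>m \<tau> (bunit ns 0 0)"
      using lin bunit_in_blockalg unfolding canon_ext_def lin_on_def by simp
    then show ?case using \<tau>c[OF bunit_in_blockalg[of ns 0 0]] ab by simp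
  next
    case (insert x S)
    obtain i j where x: "x = (i, j)" by force
    have ij: "i < m" "j < m" using insert.prems x by auto
    have "bdiag_part ns (R (insert x S)) = X $$ (i, j) \<cdot>\<^sub>m bunit ns i j + bdiag_part ns (R S)"
      using insert.hyps unfolding R_def bunit_def bdiag_part_def m_def x by (intro eq_matI) auto
    moreover have "X $$ (i, j) \<cdot>\<^sub>m bunit ns i j \<in> blockalg ns"
      using bunit_in_blockalg[of ns i j] unfolding blockalg_def by auto
    ultimately have "canon_ext ns \<tau> (R (insert x S)) = X $$ (i, j) \<cdot>\<^sub>m \<tau> (bunit ns i j) + canon_ext ns \<tau> (R S)"
      using lin bunit_in_blockalg[of ns i j] bdiag_part_in_blockalg[of ns "R S"]
      unfolding canon_ext_def lin_on_def by simp
    moreover have "canon_ext ns \<tau> (R S) \<in> carrier_mat m m"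
      unfolding canon_ext_def by (rule \<tau>c[OF bdiag_part_in_blockalg])
    ultimately show ?case
      using insert \<tau>c[OF bunit_in_blockalg[of ns i j]] ab x by simp
  qed
  from this[of "{..<m} \<times> {..<m}"]
  have "canon_ext ns \<tau> (R ({..<m} \<times> {..<m})) $$ (a, b) = (\<Sum>i<m. \<Sum>j<m. X $$ (i, j) * \<tau> (bunit ns i j) $$ (a, b))"
    by (simp add: sum.cartesian_product)
  moreover have "R ({..<m} \<times> {..<m}) = X" using X unfolding R_def by (intro eq_matI) auto
  ultimately show ?thesis by simp
qed

lemma canon_ext_in_blockalg:
  assumes "lin_on (blockalg ns) \<tau>"
  shows "canon_ext ns \<tau> X \<in> blockalg ns"
  using assms bdiag_part_in_blockalg unfolding lin_on_def canon_ext_def by blast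

text \<open>Choi's argument: the values of \<open>\<tau>\<close> at the cut matrix units fill a
  positive matrix, and each vector of its rank-one decomposition, folded into a square, is a Kraus
  operator. By linearity these values determine the extension on all of the matrix algebra.\<close>

lemma kraus_decomposition:
  fixes ns :: "nat list"
  defines "m \<equiv> sum_list ns"
  assumes cp: "completely_positive m (blockalg ns) \<tau>"
  shows "\<exists>As. set As \<subseteq> carrier_mat m m \<and> (\<forall>X\<in>carrier_mat m m. canon_ext ns \<tau> X = kraus_sum m As X)"
proof -
  have lin: "lin_on (blockalg ns) \<tau>" using cp unfolding completely_positive_def by simp
  let ?C = "assemble m m (\<lambda>i j. \<tau> (bunit ns i j))"
  have "psd (m * m) ?C"
    using cp psd_assemble_bunit[of ns] bunit_in_blockalg unfolding completely_positive_def m_def by blast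
  from psd_form_decomposition[OF _ psd_form_of_psd[OF this]]
  obtain ws :: "(nat \<Rightarrow> complex) list" where
    ws: "\<And>p q. p < m * m \<Longrightarrow> q < m * m \<Longrightarrow> ?C $$ (p, q) = (\<Sum>w\<leftarrow>ws. w p * cnj (w q))" by auto
  \<comment> \<open>Entry \<open>(i, a)\<close> comes from position \<open>(i, a)\<close> of the
    Choi vector. The conjugate is due to the adjoint standing on the left in a Kraus term, which
    conjugates the first factor once more.\<close>
  define As where "As = map (\<lambda>w. mat m m (\<lambda>(i, a). cnj (w (i * m + a)))) ws"
  have Asc: "set As \<subseteq> carrier_mat m m" unfolding As_def by auto
  have choi: "\<tau> (bunit ns i j) $$ (a, b) = (\<Sum>A\<leftarrow>As. cnj (A $$ (i, a)) * A $$ (j, b))"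
    if "i < m" "j < m" "a < m" "b < m" for i j a b
  proof -
    have lt: "k * m + c < m * m" if "k < m" "c < m" for k c
    proof -
      have "k * m + c < Suc k * m" using that by simp
      also have "\<dots> \<le> m * m" using that by (intro mult_le_mono1) simp
      finally show ?thesis .
    qed
    have "\<tau> (bunit ns i j) $$ (a, b) = ?C $$ (i * m + a, j * m + b)"
      using that lt[of i a] lt[of j b] unfolding assemble_def by simp
    also have "\<dots> = (\<Sum>w\<leftarrow>ws. w (i * m + a) * cnj (w (j * m + b)))" using ws lt that by blast
    also have "\<dots> = (\<Sum>A\<leftarrow>As. cnj (A $$ (i, a)) * A $$ (j, b))"
      unfolding As_def map_map o_def using that by simp
    finally show ?thesis .
  qed
  have "canon_ext ns \<tau> X = kraus_sum m As X" if X: "X \<in> carrier_mat m m" for X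
  proof (rule eq_matI)
    note c1 = kraus_sum_carrier[OF Asc X]
    have c2: "canon_ext ns \<tau> X \<in> carrier_mat m m"
      using blockalg_carrier[OF canon_ext_in_blockalg[OF lin]] unfolding m_def .
    show "dim_row (canon_ext ns \<tau> X) = dim_row (kraus_sum m As X)"
      "dim_col (canon_ext ns \<tau> X) = dim_col (kraus_sum m As X)" using c1 c2 by auto
    fix a b assume "a < dim_row (kraus_sum m As X)" "b < dim_col (kraus_sum m As X)"
    then have ab: "a < m" "b < m" using c1 by auto
    have "kraus_sum m As X $$ (a, b) = (\<Sum>i<m. \<Sum>j<m. \<Sum>A\<leftarrow>As. cnj (A $$ (i, a)) * X $$ (i, j) * A $$ (j, b))"
      unfolding kraus_sum_index[OF Asc X ab] sum_list_sum_swap ..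
    also have "\<dots> = (\<Sum>i<m. \<Sum>j<m. X $$ (i, j) * \<tau> (bunit ns i j) $$ (a, b))"
      by (intro sum.cong refl) (auto simp: choi ab sum_list_const_mult[symmetric] algebra_simps)
    also have "\<dots> = canon_ext ns \<tau> X $$ (a, b)"
      using canon_ext_expand[OF lin, of X a b] X ab unfolding m_def by simp
    finally show "canon_ext ns \<tau> X $$ (a, b) = kraus_sum m As X $$ (a, b)" by simp
  qed
  then show ?thesis using Asc by blast
qed

section \<open>Reducing projections\<close>

lemma projection_carrier: "projection m P \<Longrightarrow> P \<in> carrier_mat m m"
  unfolding projection_def by simp

lemma projection_complement:
  assumes "projection m P"
  shows "projection m (1\<^sub>m m - P)" "P * (1\<^sub>m m - P) = 0\<^sub>m m m" "(1\<^sub>m m - P) * P = 0\<^sub>m m m"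
    "1\<^sub>m m - (1\<^sub>m m - P) = P"
proof -
  have P: "P \<in> carrier_mat m m" "cadj P = P" "P * P = P" using assms unfolding projection_def by auto
  have Q: "1\<^sub>m m - P \<in> carrier_mat m m" by (rule minus_carrier_mat[OF P(1)])
  show a: "P * (1\<^sub>m m - P) = 0\<^sub>m m m"
    using mult_minus_distrib_mat[OF P(1) one_carrier_mat P(1)] P by simp
  show b: "(1\<^sub>m m - P) * P = 0\<^sub>m m m"
    using minus_mult_distrib_mat[OF one_carrier_mat P(1) P(1)] P by simp
  have "(1\<^sub>m m - P) * (1\<^sub>m m - P) = (1\<^sub>m m - P) * 1\<^sub>m m - (1\<^sub>m m - P) * P"
    using mult_minus_distrib_mat[OF Q one_carrier_mat P(1)] .
  then have c: "(1\<^sub>m m - P) * (1\<^sub>m m - P) = 1\<^sub>m m - P" using b Q P(1) right_mult_one_mat[OF Q] by (auto intro!: eq_matI)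
  have "cadj (1\<^sub>m m - P) = 1\<^sub>m m - P"
  proof (rule eq_matI)
    fix i j assume "i < dim_row (1\<^sub>m m - P)" "j < dim_col (1\<^sub>m m - P)"
    then have ij: "i < m" "j < m" using P by auto
    have "cadj P $$ (i, j) = cnj (P $$ (j, i))" using P(1) ij by simp
    then have "P $$ (i, j) = cnj (P $$ (j, i))" unfolding P(2) .
    then show "cadj (1\<^sub>m m - P) $$ (i, j) = (1\<^sub>m m - P) $$ (i, j)"
      using ij P(1) unfolding cadj_index[OF Q ij] by auto
  qed (use P in auto)
  then show "projection m (1\<^sub>m m - P)" using Q c unfolding projection_def by auto
  show "1\<^sub>m m - (1\<^sub>m m - P) = P" using P by (intro eq_matI) auto
qed

lemma mat_zeroI:
  assumes A: "(A :: complex mat) \<in> carrier_mat m m" and "\<And>v. v \<in> carrier_vec m \<Longrightarrow> A *\<^sub>v v = 0\<^sub>v m"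
  shows "A = 0\<^sub>m m m"
proof (rule eq_matI)
  fix i j assume "i < dim_row (0\<^sub>m m m :: complex mat)" "j < dim_col (0\<^sub>m m m :: complex mat)"
  then have ij: "i < m" "j < m" by auto
  have "A $$ (i, j) = (A *\<^sub>v unit_vec m j) $ i" using A ij by simp
  then show "A $$ (i, j) = 0\<^sub>m m m $$ (i, j)" using assms(2)[of "unit_vec m j"] ij by simp
qed (use A in auto)

text \<open>Primeness of the full matrix algebra: a matrix unit \<open>X\<close> that links a
  nonzero entry of \<open>P\<close> to one of \<open>Q\<close> makes their product an entry of
  \<open>P * X * Q\<close>.\<close>

lemma mult_eq_zero_imp:
  assumes P: "P \<in> carrier_mat m m" and Q: "Q \<in> carrier_mat m m"
    and z: "\<And>X. X \<in> carrier_mat m m \<Longrightarrow> P * X * Q = (0\<^sub>m m m :: complex mat)"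
  shows "P = 0\<^sub>m m m \<or> Q = 0\<^sub>m m m"
proof (rule ccontr)
  assume "\<not> ?thesis"
  then obtain i j k l where ij: "i < m" "j < m" "P $$ (i, j) \<noteq> 0" and kl: "k < m" "l < m" "Q $$ (k, l) \<noteq> 0"
    using nonzero_mat_entry[OF P] nonzero_mat_entry[OF Q] by blast
  define X :: "complex mat" where "X = mat m m (\<lambda>(r, s). if r = j \<and> s = k then 1 else 0)"
  have X: "X \<in> carrier_mat m m" unfolding X_def by simp
  have PX: "(P * X) $$ (i, s) = (if s = k then P $$ (i, j) else 0)" if "s < m" for s
  proof -
    have "(P * X) $$ (i, s) = (\<Sum>t<m. if t = j then (if s = k then P $$ (i, j) else 0) else 0)"
      unfolding mult_index[OF P X ij(1) that] by (rule sum.cong) (use that in \<open>auto simp: X_def\<close>)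
    then show ?thesis using ij by simp
  qed
  have PXc: "P * X \<in> carrier_mat m m" using P X by simp
  have "(P * X * Q) $$ (i, l) = (\<Sum>t<m. if t = k then P $$ (i, j) * Q $$ (k, l) else 0)"
    unfolding mult_index[OF PXc Q ij(1) kl(2)] by (rule sum.cong) (auto simp: PX)
  also have "\<dots> = P $$ (i, j) * Q $$ (k, l)" using kl by simp
  finally have "P $$ (i, j) * Q $$ (k, l) = 0" using z[OF X] ij kl by simp
  then show False using ij kl by simp
qed

lemma gen_alg_carrier: "A \<in> gen_alg m S \<Longrightarrow> A \<in> carrier_mat m m"
  by (induction rule: gen_alg.induct) auto

text \<open>The condition says that the kernel of \<open>P\<close> is invariant, which passes to
  products; in algebraic form, \<open>P * A = P * A * P\<close>.\<close>

lemma corner_zero_mult: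
  assumes P: "projection m P" and A: "A \<in> carrier_mat m m" and B: "B \<in> carrier_mat m m"
    and zA: "P * A * (1\<^sub>m m - P) = 0\<^sub>m m m" and zB: "P * B * (1\<^sub>m m - P) = 0\<^sub>m m m"
  shows "P * (A * B) * (1\<^sub>m m - P) = 0\<^sub>m m m"
proof -
  define Q where "Q = 1\<^sub>m m - P"
  have Pc: "P \<in> carrier_mat m m" by (rule projection_carrier[OF P])
  have Qc: "Q \<in> carrier_mat m m" unfolding Q_def by (rule minus_carrier_mat[OF Pc])
  note as = assoc_mult_mat[of _ m m _ m _ m]
  have PQ: "P + Q = 1\<^sub>m m" using Pc unfolding Q_def by (intro eq_matI) auto
  have "P * A = P * A * (P + Q)" unfolding PQ using Pc A by simp
  also have "\<dots> = P * A * P"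
    using mult_add_distrib_mat[of "P * A" m m P m Q] Pc Qc A zA[folded Q_def] by simp
  finally have PA: "P * A = P * A * P" .
  have "P * (A * B) * Q = (P * A) * (B * Q)" using Pc Qc A B by (simp add: as)
  also have "\<dots> = (P * A) * (P * B * Q)"
    by (subst PA) (use Pc Qc A B in \<open>simp add: as\<close>)
  also have "\<dots> = 0\<^sub>m m m" using zB[folded Q_def] Pc A by simp
  finally show ?thesis unfolding Q_def .
qed

text \<open>The matrices with vanishing corner are closed under all rules of \<open>gen_alg\<close>.
  If they included every matrix, primeness would make \<open>P\<close> or \<open>1 - P\<close>
  zero.\<close>

lemma generating_imp_no_corner:
  assumes P: "projection m P" "P \<noteq> 0\<^sub>m m m" "P \<noteq> 1\<^sub>m m"
    and gen: "gen_alg m S = carrier_mat m m"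
    and z: "\<And>A. A \<in> S \<Longrightarrow> P * A * (1\<^sub>m m - P) = 0\<^sub>m m m"
  shows False
proof -
  define Q where "Q = 1\<^sub>m m - P"
  have Pc: "P \<in> carrier_mat m m" by (rule projection_carrier[OF P(1)])
  have Qc: "Q \<in> carrier_mat m m" unfolding Q_def by (rule minus_carrier_mat[OF Pc])
  have "P * X * Q = 0\<^sub>m m m" if "X \<in> gen_alg m S" for X
    using that
  proof (induction rule: gen_alg.induct)
    case (gen A)
    then show ?case using z unfolding Q_def by simp
  next
    case one
    then show ?case using projection_complement(2)[OF P(1)] Pc unfolding Q_def by simp
  next
    case (add A B)
    then show ?case using Pc Qc gen_alg_carrier[of A m S] gen_alg_carrier[of B m S]
      by (simp add: mult_add_distrib_mat[of _ m m _ m] add_mult_distrib_mat[of _ m m _ _ m])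
  next
    case (mult A B)
    then show ?case using corner_zero_mult[OF P(1)] gen_alg_carrier unfolding Q_def by blast
  next
    case (smult A c)
    then show ?case using Pc Qc gen_alg_carrier[of A m S]
      by (simp add: mult_smult_distrib[of _ m m _ m] mult_smult_assoc_mat[of _ m m _ m])
  qed
  then have "P = 0\<^sub>m m m \<or> Q = 0\<^sub>m m m" using mult_eq_zero_imp[OF Pc Qc] gen by blast
  then have "P = 1\<^sub>m m" using P(2) projection_complement(4)[OF P(1)] unfolding Q_def[symmetric]
    by (auto intro!: eq_matI)
  then show False using P(3) by simp
qed

text \<open>Because \<open>P\<close> is a self-adjoint idempotent, each compressed term is the
  square \<open>cadj B * B\<close> of the corner \<open>B = P * A * Q\<close>.\<close>

lemma kraus_sum_conj:
  assumes "set As \<subseteq> carrier_mat m m" and P: "projection m P" and Q: "projection m Q"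
  shows "Q * kraus_sum m As P * Q = kraus_sum m (map (\<lambda>A. P * A * Q) As) (1\<^sub>m m)"
  using assms(1)
proof (induction As)
  case Nil
  then show ?case using projection_carrier[OF Q] by simp
next
  case (Cons A As)
  have Pc: "P \<in> carrier_mat m m" "cadj P = P" "P * P = P" using P unfolding projection_def by auto
  have Qc: "Q \<in> carrier_mat m m" "cadj Q = Q" using Q unfolding projection_def by auto
  have A: "A \<in> carrier_mat m m" and As: "set As \<subseteq> carrier_mat m m" using Cons.prems by auto
  note Aa = cadj_carrier[OF A] and kc = kraus_sum_carrier[OF As Pc(1)]
  note as = assoc_mult_mat[of _ m m _ m _ m]
  have "cadj (P * A * Q) = Q * (cadj A * P)"
    using cadj_mult[of "P * A" m m Q m] cadj_mult[OF Pc(1) A] Pc Qc A by simp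
  then have "cadj (P * A * Q) * 1\<^sub>m m * (P * A * Q) = Q * (cadj A * (P * P)) * (A * Q)"
    using Pc(1) Qc(1) A Aa by (simp add: as)
  also have "\<dots> = Q * (cadj A * P * A) * Q"
    unfolding Pc(3) using Pc(1) Qc(1) A Aa by (simp add: as)
  finally have "cadj (P * A * Q) * 1\<^sub>m m * (P * A * Q) = Q * (cadj A * P * A) * Q" .
  moreover have "Q * (cadj A * P * A + kraus_sum m As P) * Q = Q * (cadj A * P * A) * Q + Q * kraus_sum m As P * Q"
    using Qc(1) conj_carrier[OF A Pc(1)] kc
    by (simp add: mult_add_distrib_mat[of _ m m _ m] add_mult_distrib_mat[of _ m m _ _ m])
  ultimately show ?case using Cons.IH[OF As] by simp
qed

text \<open>Diagonal entry \<open>j\<close> of the sum collects the squared moduli of column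
  \<open>j\<close> over all the operators.\<close>

lemma kraus_sum_one_zero:
  assumes "set Bs \<subseteq> carrier_mat m m" "kraus_sum m Bs (1\<^sub>m m) = 0\<^sub>m m m" "B \<in> set Bs"
  shows "B = 0\<^sub>m m m"
proof (rule eq_matI)
  have B: "B \<in> carrier_mat m m" using assms by auto
  then show "dim_row B = dim_row (0\<^sub>m m m :: complex mat)" "dim_col B = dim_col (0\<^sub>m m m :: complex mat)" by auto
  fix i j assume "i < dim_row (0\<^sub>m m m :: complex mat)" "j < dim_col (0\<^sub>m m m :: complex mat)"
  then have ij: "i < m" "j < m" by auto
  have e: "(\<Sum>t<m. \<Sum>s<m. cnj (C $$ (t, j)) * 1\<^sub>m m $$ (t, s) * C $$ (s, j)) = of_real (\<Sum>t<m. (cmod (C $$ (t, j)))\<^sup>2)" for C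
  proof -
    have "(\<Sum>t<m. \<Sum>s<m. cnj (C $$ (t, j)) * 1\<^sub>m m $$ (t, s) * C $$ (s, j)) =
      (\<Sum>t<m. \<Sum>s<m. if s = t then cnj (C $$ (t, j)) * C $$ (t, j) else 0)"
      by (intro sum.cong refl) auto
    also have "\<dots> = (\<Sum>t<m. cnj (C $$ (t, j)) * C $$ (t, j))" by simp
    finally show ?thesis unfolding of_real_sum complex_norm_square by (simp add: mult.commute)
  qed
  have of_real_list: "(\<Sum>C\<leftarrow>Bs. of_real (f C)) = (of_real (\<Sum>C\<leftarrow>Bs. f C) :: complex)" for f :: "complex mat \<Rightarrow> real"
    by (induction Bs) auto
  have "of_real (\<Sum>C\<leftarrow>Bs. \<Sum>t<m. (cmod (C $$ (t, j)))\<^sup>2) = (0 :: complex)"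
    using kraus_sum_index[OF assms(1) one_carrier_mat ij(2) ij(2)] assms(2) ij unfolding e of_real_list by simp
  then have "(\<Sum>C\<leftarrow>Bs. \<Sum>t<m. (cmod (C $$ (t, j)))\<^sup>2) = 0" by (simp only: of_real_eq_0_iff)
  then have "(\<Sum>t<m. (cmod (B $$ (t, j)))\<^sup>2) = 0"
    using assms(3) by (subst (asm) sum_list_nonneg_eq_0_iff) (auto intro: sum_nonneg)
  then show "B $$ (i, j) = 0\<^sub>m m m $$ (i, j)" using ij by (auto simp: sum_nonneg_eq_0_iff)
qed

text \<open>From \<open>P * A = P * A * P\<close> and its adjoint, every term with middle factor
  \<open>P * X * P\<close> absorbs \<open>P\<close> on both sides.\<close>

lemma kraus_sum_corner:
  assumes "set As \<subseteq> carrier_mat m m" and P: "projection m P" and X: "X \<in> carrier_mat m m"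
    and z: "\<And>A. A \<in> set As \<Longrightarrow> P * A * (1\<^sub>m m - P) = 0\<^sub>m m m"
  shows "P * kraus_sum m As (P * X * P) * P = kraus_sum m As (P * X * P)"
  using assms(1) z
proof (induction As)
  case Nil
  then show ?case using projection_carrier[OF P] by simp
next
  case (Cons A As)
  have Pc: "P \<in> carrier_mat m m" "cadj P = P" "P * P = P" using P unfolding projection_def by auto
  have A: "A \<in> carrier_mat m m" and As: "set As \<subseteq> carrier_mat m m" using Cons.prems by auto
  define Q where "Q = 1\<^sub>m m - P"
  have Qc: "Q \<in> carrier_mat m m" unfolding Q_def by (rule minus_carrier_mat[OF Pc(1)])
  define Y where "Y = P * X * P"
  have Y: "Y \<in> carrier_mat m m" unfolding Y_def using Pc X by simp
  note as = assoc_mult_mat[of _ m m _ m _ m]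
  note Aa = cadj_carrier[OF A] and kc = kraus_sum_carrier[OF As Y]
  have PQ: "P + Q = 1\<^sub>m m" using Pc unfolding Q_def by (intro eq_matI) auto
  have "P * A = P * A * (P + Q)" unfolding PQ using Pc(1) A by simp
  also have "\<dots> = P * A * P"
    using mult_add_distrib_mat[of "P * A" m m P m Q] Pc Qc A Cons.prems(2)[of A, folded Q_def] by simp
  finally have PA: "P * A * P = P * A" by simp
  have "cadj (P * A * P) = P * (cadj A * P)"
    using cadj_mult[of "P * A" m m P m] cadj_mult[OF Pc(1) A] Pc A by simp
  then have PA': "P * (cadj A * P) = cadj A * P" unfolding PA using cadj_mult[OF Pc(1) A] Pc by simp
  have YP: "Y = P * Y * P"
  proof -
    have "P * Y * P = (P * P) * X * (P * P)" unfolding Y_def using Pc(1) X by (simp add: as)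
    then show ?thesis unfolding Pc(3) Y_def by simp
  qed
  have "cadj A * Y * A = (cadj A * P) * Y * (P * A)"
    by (subst YP) (use Pc(1) Y A Aa in \<open>simp add: as\<close>)
  then have f: "cadj A * Y * A = (cadj A * P) * (Y * (P * A))" using Pc(1) Y A Aa by (simp add: as)
  have "P * (cadj A * Y * A) * P = (P * (cadj A * P)) * (Y * (P * A * P))"
    unfolding f using Pc(1) Y A Aa by (simp add: as)
  also have "\<dots> = cadj A * Y * A" unfolding PA PA' f ..
  finally have "P * (cadj A * Y * A) * P = cadj A * Y * A" .
  moreover have "P * (cadj A * Y * A + kraus_sum m As Y) * P = P * (cadj A * Y * A) * P + P * kraus_sum m As Y * P"
    using Pc(1) conj_carrier[OF A Y] kc
    by (simp add: mult_add_distrib_mat[of _ m m _ m] add_mult_distrib_mat[of _ m m _ _ m])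
  ultimately show ?case using Cons.IH[OF As] Cons.prems(2) unfolding Y_def[symmetric] by simp
qed

text \<open>One direction needs only the value at \<open>P\<close>, the unit of the corner: it lies
  in the corner, so its compression by \<open>1 - P\<close> vanishes and is a sum of squares. In the
  other direction each Kraus term stays in the corner.\<close>

lemma reducing_iff_corner_zero:
  assumes As: "set As \<subseteq> carrier_mat m m" and P: "projection m P" "P \<in> B"
    and B: "B \<subseteq> carrier_mat m m" "1\<^sub>m m \<in> B" "\<forall>X\<in>B. \<forall>Y\<in>B. X * Y \<in> B"
    and \<tau>: "\<forall>X\<in>B. \<tau> X \<in> B" "\<forall>X\<in>B. \<tau> X = kraus_sum m As X"
  shows "\<tau> ` {P * X * P | X. X \<in> B} \<subseteq> {P * X * P | X. X \<in> B} \<longleftrightarrow>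
    (\<forall>A\<in>set As. P * A * (1\<^sub>m m - P) = 0\<^sub>m m m)"
proof
  define Q where "Q = 1\<^sub>m m - P"
  have Pc: "P \<in> carrier_mat m m" "P * P = P" using P unfolding projection_def by auto
  have Qc: "Q \<in> carrier_mat m m" unfolding Q_def by (rule minus_carrier_mat[OF Pc(1)])
  have Qp: "projection m Q" unfolding Q_def by (rule projection_complement(1)[OF P(1)])
  {
    assume "\<tau> ` {P * X * P | X. X \<in> B} \<subseteq> {P * X * P | X. X \<in> B}"
    moreover have "P \<in> {P * X * P | X. X \<in> B}" using B(2) Pc by (auto intro!: exI[of _ "1\<^sub>m m"])
    ultimately obtain Y where Y: "\<tau> P = P * Y * P" "Y \<in> B" by blast
    have Yc: "Y \<in> carrier_mat m m" using Y B by auto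
    have "Q * (P * Y * P) * Q = (Q * P) * (Y * (P * Q))"
      using Pc(1) Qc Yc by (simp add: assoc_mult_mat[of _ m m _ m _ m])
    also have "\<dots> = 0\<^sub>m m m" using projection_complement(2,3)[OF P(1)] Yc unfolding Q_def by simp
    finally have "kraus_sum m (map (\<lambda>A. P * A * Q) As) (1\<^sub>m m) = 0\<^sub>m m m"
      using kraus_sum_conj[OF As P(1) Qp] bspec[OF \<tau>(2) P(2)] Y(1) by simp
    moreover have "set (map (\<lambda>A. P * A * Q) As) \<subseteq> carrier_mat m m" using As Pc(1) Qc by fastforce
    ultimately have "P * A * Q = 0\<^sub>m m m" if "A \<in> set As" for A
      using kraus_sum_one_zero[of "map (\<lambda>A. P * A * Q) As" m "P * A * Q"] that by auto
    then show "\<forall>A\<in>set As. P * A * (1\<^sub>m m - P) = 0\<^sub>m m m" unfolding Q_def by blast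
  }
  {
    assume z: "\<forall>A\<in>set As. P * A * (1\<^sub>m m - P) = 0\<^sub>m m m"
    have "\<tau> (P * X * P) \<in> {P * X * P | X. X \<in> B}" if X: "X \<in> B" for X
    proof -
      have PXP: "P * X * P \<in> B" using B(3) P(2) X by blast
      then have "\<tau> (P * X * P) = P * \<tau> (P * X * P) * P"
        using kraus_sum_corner[OF As P(1), of X] z X B(1) bspec[OF \<tau>(2) PXP] by auto
      then show ?thesis using bspec[OF \<tau>(1) PXP] by blast
    qed
    then show "\<tau> ` {P * X * P | X. X \<in> B} \<subseteq> {P * X * P | X. X \<in> B}" by auto
  }
qed

text \<open>The corner condition concerns the kernel of the projection, so the witness is the
  projection onto the orthogonal complement of \<open>K\<close>.\<close>

lemma invariant_subspace_corner_zero: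
  assumes K: "csubspace m K" "K \<noteq> {0\<^sub>v m}" "K \<noteq> carrier_vec m"
  obtains P where "projection m P" "P \<noteq> 0\<^sub>m m m" "P \<noteq> 1\<^sub>m m"
    "\<And>A. A \<in> carrier_mat m m \<Longrightarrow> (\<And>v. v \<in> K \<Longrightarrow> A *\<^sub>v v \<in> K) \<Longrightarrow> P * A * (1\<^sub>m m - P) = 0\<^sub>m m m"
proof -
  obtain r V where V: "V \<in> carrier_mat m r" "cadj V * V = 1\<^sub>m r"
    and VK: "\<And>u. u \<in> carrier_vec r \<Longrightarrow> V *\<^sub>v u \<in> K"
    and Vv: "\<And>v. v \<in> K \<Longrightarrow> V *\<^sub>v (cadj V *\<^sub>v v) = v"
    using subspace_isometry[OF K(1)] by metis
  note Va = cadj_carrier[OF V(1)] and Kc = csubspaceD(1)[OF K(1)]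
  define E where "E = V * cadj V"
  have Ec: "E \<in> carrier_mat m m" unfolding E_def using V Va by simp
  have Ev: "E *\<^sub>v v = V *\<^sub>v (cadj V *\<^sub>v v)" if "v \<in> carrier_vec m" for v
    unfolding E_def by (rule assoc_mult_mat_vec[OF V(1) Va that])
  have EK: "E *\<^sub>v v \<in> K" if "v \<in> carrier_vec m" for v
    unfolding Ev[OF that] using VK Va that by simp
  have EE: "E *\<^sub>v v = v" if "v \<in> K" for v using Ev[OF Kc[OF that]] Vv[OF that] by simp
  have "E * E = V * (cadj V * V) * cadj V"
    unfolding E_def using V(1) Va by (simp add: assoc_mult_mat[of _ m r _ m _ m] assoc_mult_mat[of _ r m _ r _ m] assoc_mult_mat[of _ m r _ r _ m])
  then have "E * E = E" using V unfolding E_def by simp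
  moreover have "cadj E = E" unfolding E_def using cadj_mult[OF V(1) Va] by simp
  ultimately have Ep: "projection m E" using Ec unfolding projection_def by simp
  define P where "P = 1\<^sub>m m - E"
  have Pc: "P \<in> carrier_mat m m" unfolding P_def by (rule minus_carrier_mat[OF Ec])
  have PE: "1\<^sub>m m - P = E" unfolding P_def by (rule projection_complement(4)[OF Ep])
  have Pv: "P *\<^sub>v v = v - E *\<^sub>v v" if "v \<in> carrier_vec m" for v
    unfolding P_def using minus_mult_distrib_mat_vec[OF one_carrier_mat Ec that] that by simp
  have PK: "P *\<^sub>v v = 0\<^sub>v m" if "v \<in> K" for v
    using Pv[OF Kc[OF that]] EE[OF that] Kc[OF that] by simp
  have "P \<noteq> 0\<^sub>m m m"
  proof
    assume "P = 0\<^sub>m m m"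
    then have "E = 1\<^sub>m m" using PE by (auto intro!: eq_matI)
    then have "v \<in> K" if "v \<in> carrier_vec m" for v using EK[OF that] that by simp
    then show False using K(3) Kc by blast
  qed
  moreover have "P \<noteq> 1\<^sub>m m"
  proof
    assume "P = 1\<^sub>m m"
    then have "v = 0\<^sub>v m" if "v \<in> K" for v using PK[OF that] Kc[OF that] by simp
    then show False using K(2) csubspaceD(2)[OF K(1)] by blast
  qed
  moreover have "P * A * (1\<^sub>m m - P) = 0\<^sub>m m m" if A: "A \<in> carrier_mat m m" and AK: "\<And>v. v \<in> K \<Longrightarrow> A *\<^sub>v v \<in> K" for A
    unfolding PE
  proof (rule mat_zeroI)
    show "P * A * E \<in> carrier_mat m m" using Pc A Ec by simp
    fix v :: "complex vec" assume v: "v \<in> carrier_vec m"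
    have "P * A * E *\<^sub>v v = P *\<^sub>v (A *\<^sub>v (E *\<^sub>v v))"
      using Pc A Ec v by (simp add: assoc_mult_mat_vec[of _ m m _ m])
    then show "P * A * E *\<^sub>v v = 0\<^sub>v m" using PK[OF AK[OF EK[OF v]]] by simp
  qed
  ultimately show ?thesis using that projection_complement(1)[OF Ep] unfolding P_def by blast
qed

section \<open>Graded subspaces and block cuts\<close>

definition bproj :: "nat list \<Rightarrow> nat \<Rightarrow> complex mat" where
  "bproj ns a = mat (sum_list ns) (sum_list ns) (\<lambda>(i, j). if i = j \<and> blk ns i = a then 1 else 0)"

lemma bproj_carrier: "bproj ns a \<in> carrier_mat (sum_list ns) (sum_list ns)"
  unfolding bproj_def by simp

lemma cadj_bproj: "cadj (bproj ns a) = bproj ns a"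
  unfolding bproj_def cadj_def by (intro eq_matI) auto

lemma bproj_vec_index:
  assumes "v \<in> carrier_vec (sum_list ns)" "i < sum_list ns"
  shows "(bproj ns a *\<^sub>v v) $ i = (if blk ns i = a then v $ i else 0)"
proof -
  have "(bproj ns a *\<^sub>v v) $ i = (\<Sum>t<sum_list ns. if t = i then (if blk ns i = a then v $ i else 0) else 0)"
    unfolding mult_vec_index[OF bproj_carrier assms] using assms(2)
    by (intro sum.cong) (auto simp: bproj_def)
  then show ?thesis using assms(2) by simp
qed

lemma bproj_mult_index:
  assumes A: "A \<in> carrier_mat (sum_list ns) (sum_list ns)" and "i < sum_list ns" "j < sum_list ns"
  shows "(bproj ns a * A) $$ (i, j) = (if blk ns i = a then A $$ (i, j) else 0)"
    and "(A * bproj ns a) $$ (i, j) = (if blk ns j = a then A $$ (i, j) else 0)"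
proof -
  have "(bproj ns a * A) $$ (i, j) = (\<Sum>t<sum_list ns. if t = i then (if blk ns i = a then A $$ (i, j) else 0) else 0)"
    unfolding mult_index[OF bproj_carrier assms] using assms
    by (intro sum.cong) (auto simp: bproj_def)
  then show "(bproj ns a * A) $$ (i, j) = (if blk ns i = a then A $$ (i, j) else 0)" using assms by simp
  have "(A * bproj ns a) $$ (i, j) = (\<Sum>t<sum_list ns. if t = j then (if blk ns j = a then A $$ (i, j) else 0) else 0)"
    unfolding mult_index[OF A bproj_carrier assms(2,3)] using assms
    by (intro sum.cong) (auto simp: bproj_def)
  then show "(A * bproj ns a) $$ (i, j) = (if blk ns j = a then A $$ (i, j) else 0)" using assms by simp
qed

lemma bproj_bproj_vec:
  assumes "v \<in> carrier_vec (sum_list ns)"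
  shows "bproj ns c *\<^sub>v (bproj ns a *\<^sub>v v) = (if c = a then bproj ns a *\<^sub>v v else 0\<^sub>v (sum_list ns))"
proof (rule eq_vecI)
  have w: "bproj ns a *\<^sub>v v \<in> carrier_vec (sum_list ns)" using bproj_carrier[of ns a] by (intro carrier_vecI) simp
  show "dim_vec (bproj ns c *\<^sub>v (bproj ns a *\<^sub>v v)) = dim_vec (if c = a then bproj ns a *\<^sub>v v else 0\<^sub>v (sum_list ns))"
    using bproj_carrier[of ns a] bproj_carrier[of ns c] by simp
  fix i assume "i < dim_vec (if c = a then bproj ns a *\<^sub>v v else 0\<^sub>v (sum_list ns))"
  then have i: "i < sum_list ns" using bproj_carrier[of ns a] by (auto split: if_splits)
  show "(bproj ns c *\<^sub>v (bproj ns a *\<^sub>v v)) $ i = (if c = a then bproj ns a *\<^sub>v v else 0\<^sub>v (sum_list ns)) $ i"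
    unfolding bproj_vec_index[OF w i] bproj_vec_index[OF assms i] using i bproj_vec_index[OF assms i, of a] by auto
qed

text \<open>For \<open>a\<close> the block of row \<open>i\<close>, multiplying by
  \<open>bproj ns a\<close> from the left keeps the entry \<open>(i, j)\<close>, while multiplying
  from the right deletes it if \<open>j\<close> lies in another block.\<close>

lemma bproj_commute_in_blockalg:
  assumes P: "P \<in> carrier_mat (sum_list ns) (sum_list ns)"
    and comm: "\<And>a. a < length ns \<Longrightarrow> bproj ns a * P = P * bproj ns a"
  shows "P \<in> blockalg ns"
proof -
  have "P $$ (i, j) = 0" if "i < sum_list ns" "j < sum_list ns" "blk ns i \<noteq> blk ns j" for i j
    using bproj_mult_index[OF P that(1,2), of "blk ns i"] comm[OF blk_less[OF that(1)]] that(3) by simp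
  then show ?thesis using P unfolding blockalg_def by simp
qed

definition block_cuts :: "nat list \<Rightarrow> complex mat list \<Rightarrow> complex mat list" where
  "block_cuts ns As = concat (map (\<lambda>A. concat (map (\<lambda>a. map (\<lambda>b. bproj ns a * A * bproj ns b)
     [0..<length ns]) [0..<length ns])) As)"

lemma set_block_cuts:
  "set (block_cuts ns As) = {bproj ns a * A * bproj ns b | a A b. a < length ns \<and> A \<in> set As \<and> b < length ns}"
  unfolding block_cuts_def by fastforce

lemma sum_list_concat_map: "(\<Sum>y\<leftarrow>concat (map g xs). f y) = (\<Sum>x\<leftarrow>xs. \<Sum>y\<leftarrow>g x. f y :: complex)"
  by (induction xs) auto

text \<open>Cutting turns a term into \<open>p_b A^* p_a X p_a A p_b\<close>. Summing over
  \<open>a\<close> replaces \<open>X\<close> by its block-diagonal part, and summing over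
  \<open>b\<close> does the same to the result.\<close>

lemma kraus_sum_block_cuts:
  fixes ns :: "nat list"
  defines "m \<equiv> sum_list ns"
  assumes As: "set As \<subseteq> carrier_mat m m" and X: "X \<in> carrier_mat m m"
  shows "kraus_sum m (block_cuts ns As) X = bdiag_part ns (kraus_sum m As (bdiag_part ns X))"
proof (rule eq_matI)
  let ?L = "length ns"
  have p: "bproj ns a \<in> carrier_mat m m" for a unfolding m_def by (rule bproj_carrier)
  have cuts: "set (block_cuts ns As) \<subseteq> carrier_mat m m"
    unfolding set_block_cuts using As p by (auto intro!: mult_carrier_mat)
  have bX: "bdiag_part ns X \<in> carrier_mat m m" unfolding bdiag_part_def m_def by simp
  note c = kraus_sum_carrier[OF cuts X]
  show "dim_row (kraus_sum m (block_cuts ns As) X) = dim_row (bdiag_part ns (kraus_sum m As (bdiag_part ns X)))"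
    "dim_col (kraus_sum m (block_cuts ns As) X) = dim_col (bdiag_part ns (kraus_sum m As (bdiag_part ns X)))"
    using c unfolding bdiag_part_def m_def by auto
  fix k l
  assume "k < dim_row (bdiag_part ns (kraus_sum m As (bdiag_part ns X)))"
    "l < dim_col (bdiag_part ns (kraus_sum m As (bdiag_part ns X)))"
  then have kl: "k < m" "l < m" unfolding bdiag_part_def m_def by auto
  have cut: "(bproj ns a * A * bproj ns b) $$ (i, j) = (if blk ns i = a \<and> blk ns j = b then A $$ (i, j) else 0)"
    if "A \<in> set As" "i < m" "j < m" for A a b i j
  proof -
    have A: "A \<in> carrier_mat m m" using As that by auto
    then have pA: "bproj ns a * A \<in> carrier_mat m m" using mult_carrier_mat[OF p] by blast
    show ?thesis
      using bproj_mult_index(2)[of "bproj ns a * A" ns i j b] bproj_mult_index(1)[of A ns i j a] A pA that unfolding m_def by auto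
  qed
  have "kraus_sum m (block_cuts ns As) X $$ (k, l) = (\<Sum>A\<leftarrow>As. \<Sum>a<?L. \<Sum>b<?L. \<Sum>i<m. \<Sum>j<m.
      cnj ((bproj ns a * A * bproj ns b) $$ (i, k)) * X $$ (i, j) * (bproj ns a * A * bproj ns b) $$ (j, l))"
    unfolding kraus_sum_index[OF cuts X kl] unfolding block_cuts_def sum_list_concat_map
    by (simp add: o_def interv_sum_list_conv_sum_set_nat lessThan_atLeast0 del: index_mult_mat)
  also have "\<dots> = (\<Sum>A\<leftarrow>As. if blk ns k = blk ns l then
      (\<Sum>i<m. \<Sum>j<m. cnj (A $$ (i, k)) * bdiag_part ns X $$ (i, j) * A $$ (j, l)) else 0)"
  proof (rule arg_cong[of _ _ sum_list], rule map_cong[OF refl])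
    fix A assume A: "A \<in> set As"
    let ?g = "\<lambda>i j. cnj (A $$ (i, k)) * X $$ (i, j) * A $$ (j, l)"
    \<comment> \<open>For fixed \<open>i\<close> and \<open>j\<close> only
      \<open>a = blk ns i\<close> and \<open>b = blk ns k\<close> contribute, and only if the blocks
      of \<open>j\<close> and \<open>l\<close> match them. Writing this as nested conditionals lets
      the block sums collapse once they are innermost.\<close>
    have "(\<Sum>a<?L. \<Sum>b<?L. \<Sum>i<m. \<Sum>j<m.
      cnj ((bproj ns a * A * bproj ns b) $$ (i, k)) * X $$ (i, j) * (bproj ns a * A * bproj ns b) $$ (j, l))
      = (\<Sum>a<?L. \<Sum>b<?L. \<Sum>i<m. \<Sum>j<m. if b = blk ns k then if a = blk ns i then
          if blk ns i = blk ns j \<and> blk ns k = blk ns l then ?g i j else 0 else 0 else 0)"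
      by (intro sum.cong refl) (auto simp: cut[OF A] kl)
    also have "\<dots> = (\<Sum>i<m. \<Sum>j<m. \<Sum>a<?L. \<Sum>b<?L. if b = blk ns k then if a = blk ns i then
          if blk ns i = blk ns j \<and> blk ns k = blk ns l then ?g i j else 0 else 0 else 0)"
      unfolding sum.cartesian_product by (rule sum.reindex_bij_witness[of _
        "\<lambda>(i, j, a, b). (a, b, i, j)" "\<lambda>(a, b, i, j). (i, j, a, b)"]) auto
    also have "\<dots> = (\<Sum>i<m. \<Sum>j<m. if blk ns i = blk ns j \<and> blk ns k = blk ns l then ?g i j else 0)"
      using blk_less[of _ ns] kl by (intro sum.cong refl) (auto simp: m_def)
    also have "\<dots> = (if blk ns k = blk ns l then
      (\<Sum>i<m. \<Sum>j<m. cnj (A $$ (i, k)) * bdiag_part ns X $$ (i, j) * A $$ (j, l)) else 0)"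
      by (auto intro!: sum.cong simp: bdiag_part_def m_def)
    finally show "(\<Sum>a<?L. \<Sum>b<?L. \<Sum>i<m. \<Sum>j<m.
      cnj ((bproj ns a * A * bproj ns b) $$ (i, k)) * X $$ (i, j) * (bproj ns a * A * bproj ns b) $$ (j, l))
      = (if blk ns k = blk ns l then
      (\<Sum>i<m. \<Sum>j<m. cnj (A $$ (i, k)) * bdiag_part ns X $$ (i, j) * A $$ (j, l)) else 0)" .
  qed
  also have "\<dots> = (if blk ns k = blk ns l then kraus_sum m As (bdiag_part ns X) $$ (k, l) else 0)"
    unfolding kraus_sum_index[OF As bX kl] by simp
  also have "\<dots> = bdiag_part ns (kraus_sum m As (bdiag_part ns X)) $$ (k, l)"
    using kl by (simp add: bdiag_part_def m_def)
  finally show "kraus_sum m (block_cuts ns As) X $$ (k, l) = bdiag_part ns (kraus_sum m As (bdiag_part ns X)) $$ (k, l)" .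
qed

text \<open>For an invariant subspace \<open>K\<close>, both the largest graded subspace contained in \<open>K\<close> and the
  smallest one containing \<open>K\<close> are invariant. If neither is proper, all the operators vanish and
  a coordinate axis does the job.\<close>
lemma graded_invariant_subspace:
  fixes ns :: "nat list"
  defines "m \<equiv> sum_list ns"
  assumes S: "S \<subseteq> carrier_mat m m" and K: "csubspace m K" "K \<noteq> {0\<^sub>v m}" "K \<noteq> carrier_vec m"
    and inv: "\<And>A a b v. A \<in> S \<Longrightarrow> a < length ns \<Longrightarrow> b < length ns \<Longrightarrow> v \<in> K \<Longrightarrow>
      bproj ns a *\<^sub>v (A *\<^sub>v (bproj ns b *\<^sub>v v)) \<in> K"
  obtains L where "csubspace m L" "L \<noteq> {0\<^sub>v m}" "L \<noteq> carrier_vec m"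
    "\<And>A a b v. A \<in> S \<Longrightarrow> a < length ns \<Longrightarrow> b < length ns \<Longrightarrow> v \<in> L \<Longrightarrow>
      bproj ns a *\<^sub>v (A *\<^sub>v (bproj ns b *\<^sub>v v)) \<in> L"
    "\<And>a v. a < length ns \<Longrightarrow> v \<in> L \<Longrightarrow> bproj ns a *\<^sub>v v \<in> L"
proof -
  note Kd = csubspaceD[OF K(1)]
  let ?p = "\<lambda>a v. bproj ns a *\<^sub>v v" and ?n = "length ns"
  have pm: "bproj ns a \<in> carrier_mat m m" for a unfolding m_def by (rule bproj_carrier)
  have pc: "?p a v \<in> carrier_vec m" for a v using pm[of a] by (intro carrier_vecI) simp
  have padd: "?p a (v + w) = ?p a v + ?p a w" if "v \<in> carrier_vec m" "w \<in> carrier_vec m" for a v w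
    using mult_add_distrib_mat_vec[OF pm that] .
  have psm: "?p a (c \<cdot>\<^sub>v v) = c \<cdot>\<^sub>v ?p a v" if "v \<in> carrier_vec m" for a c v
    using mult_mat_vec[OF pm that] .
  have p0: "?p a (0\<^sub>v m) = 0\<^sub>v m" for a using mult_mat_zero_vec[OF pm] .
  have pp: "?p c (?p a v) = (if c = a then ?p a v else 0\<^sub>v m)" if "v \<in> carrier_vec m" for a c v
    using bproj_bproj_vec[of v ns c a] that unfolding m_def by simp
  have Avc: "A *\<^sub>v v \<in> carrier_vec m" if "A \<in> S" for A v
    using S that by (intro carrier_vecI) auto
  \<comment> \<open>\<open>Km\<close> is the largest graded subspace inside \<open>K\<close>;
    \<open>Kp\<close> is the smallest graded one around \<open>K\<close>, allowing a different
    vector of \<open>K\<close> for each block component.\<close>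
  define Km where "Km = {v \<in> carrier_vec m. \<forall>a<?n. ?p a v \<in> K}"
  define Kp where "Kp = {v \<in> carrier_vec m. \<forall>a<?n. \<exists>k\<in>K. ?p a v = ?p a k}"
  have Km_sub: "csubspace m Km"
    by (rule csubspaceI) (auto simp: Km_def p0 padd psm Kd)
  have Kp_sub: "csubspace m Kp"
  proof (rule csubspaceI)
    show "Kp \<subseteq> carrier_vec m" "0\<^sub>v m \<in> Kp" unfolding Kp_def using Kd(2) by auto
    fix v w c assume v: "v \<in> Kp"
    show "c \<cdot>\<^sub>v v \<in> Kp" unfolding Kp_def mem_Collect_eq
    proof (intro conjI allI impI)
      show "c \<cdot>\<^sub>v v \<in> carrier_vec m" using v unfolding Kp_def by simp
      fix a assume "a < ?n"
      then obtain k where k: "k \<in> K" "?p a v = ?p a k" using v unfolding Kp_def by blast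
      then have "?p a (c \<cdot>\<^sub>v v) = ?p a (c \<cdot>\<^sub>v k)" using psm v Kd(1) unfolding Kp_def by simp
      then show "\<exists>k\<in>K. ?p a (c \<cdot>\<^sub>v v) = ?p a k" using Kd(4)[OF k(1)] by blast
    qed
    assume w: "w \<in> Kp"
    show "v + w \<in> Kp" unfolding Kp_def mem_Collect_eq
    proof (intro conjI allI impI)
      show "v + w \<in> carrier_vec m" using v w unfolding Kp_def by simp
      fix a assume "a < ?n"
      then obtain k k' where k: "k \<in> K" "?p a v = ?p a k" "k' \<in> K" "?p a w = ?p a k'"
        using v w unfolding Kp_def by blast
      then have "?p a (v + w) = ?p a (k + k')" using padd v w Kd(1) unfolding Kp_def by simp
      then show "\<exists>k\<in>K. ?p a (v + w) = ?p a k" using Kd(3)[OF k(1,3)] by blast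
    qed
  qed
  have Km_p: "?p a v \<in> Km" if "a < ?n" "v \<in> Km" for a v
    using that Kd(2) unfolding Km_def by (auto simp: pp pc)
  have Kp_p: "?p a v \<in> Kp" if "a < ?n" "v \<in> Kp" for a v
    unfolding Kp_def mem_Collect_eq
  proof (intro conjI allI impI)
    show "?p a v \<in> carrier_vec m" by (rule pc)
    fix c assume "c < ?n"
    have vc: "v \<in> carrier_vec m" using that unfolding Kp_def by simp
    show "\<exists>k\<in>K. ?p c (?p a v) = ?p c k"
    proof (cases "c = a")
      case True
      then show ?thesis using that pp[OF vc] unfolding Kp_def by auto
    next
      case False
      then show ?thesis using pp[OF vc] p0 Kd(2) by (auto intro!: bexI[of _ "0\<^sub>v m"])
    qed
  qed
  have KKp: "K \<subseteq> Kp" unfolding Kp_def using Kd(1) by auto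
  have into_Km: "?p a w \<in> Km" if "?p a w \<in> K" "w \<in> carrier_vec m" for a w
    using that Kd(2) unfolding Km_def by (auto simp: pp pc)
  have Km_inv: "?p a (A *\<^sub>v ?p b v) \<in> Km" if A: "A \<in> S" "a < ?n" "b < ?n" and v: "v \<in> Km" for A a b v
  proof -
    have vc: "v \<in> carrier_vec m" and "?p b v \<in> K" using v A unfolding Km_def by auto
    then have "?p a (A *\<^sub>v ?p b (?p b v)) \<in> K" using inv A by blast
    then show ?thesis using into_Km Avc[OF A(1)] pp[OF vc] by simp
  qed
  \<comment> \<open>Stronger than invariance of \<open>Kp\<close>: a cut operator sees only one
    block component, which \<open>v\<close> shares with some vector of \<open>K\<close>, so the
    value already lies in \<open>K\<close>.\<close>
  have Kp_inv: "?p a (A *\<^sub>v ?p b v) \<in> K" if A: "A \<in> S" "a < ?n" "b < ?n" and v: "v \<in> Kp" for A a b v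
  proof -
    obtain k where "k \<in> K" "?p b v = ?p b k" using v A unfolding Kp_def by blast
    then show ?thesis using inv A by simp
  qed
  have Kp_ne: "Kp \<noteq> {0\<^sub>v m}" using KKp K(2) Kd(2) by auto
  have unit: "unit_vec m i = ?p (blk ns i) (unit_vec m i)" if "i < m" for i
    using that pm[of "blk ns i"] by (intro eq_vecI) (auto simp: bproj_vec_index m_def simp del: index_mult_mat_vec)
  \<comment> \<open>Each unit vector lies in a single block, so if \<open>Km\<close> were
    everything, \<open>K\<close> would contain all unit vectors.\<close>
  have Km_ne: "Km \<noteq> carrier_vec m"
  proof
    assume all: "Km = carrier_vec m"
    have un: "unit_vec m i \<in> K" if "i < m" for i
    proof -
      have "unit_vec m i \<in> Km" using all by simp
      then have "?p (blk ns i) (unit_vec m i) \<in> K" using blk_less[of i ns] that unfolding Km_def m_def by auto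
      then show ?thesis using unit[OF that] by simp
    qed
    have "v \<in> K" if v: "v \<in> carrier_vec m" for v
    proof -
      have "vec m (\<lambda>i. if i < k then v $ i else 0) \<in> K" if "k \<le> m" for k
        using that
      proof (induction k)
        case 0
        have "vec m (\<lambda>i. if i < 0 then v $ i else 0) = 0\<^sub>v m" by (intro eq_vecI) auto
        then show ?case using Kd(2) by (simp only:)
      next
        case (Suc k)
        have "vec m (\<lambda>i. if i < Suc k then v $ i else 0) = vec m (\<lambda>i. if i < k then v $ i else 0) + v $ k \<cdot>\<^sub>v unit_vec m k"
          using Suc.prems by (intro eq_vecI) (auto simp: less_Suc_eq)
        then show ?case using Suc Kd(3)[OF _ Kd(4)[OF un]] by simp
      qed
      from this[of m] have "vec m (\<lambda>i. if i < m then v $ i else 0) \<in> K" by simp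
      moreover have "vec m (\<lambda>i. if i < m then v $ i else 0) = v" using v by (intro eq_vecI) auto
      ultimately show ?thesis by simp
    qed
    then show False using K(3) Kd(1) by blast
  qed
  show ?thesis
  proof (cases "Km = {0\<^sub>v m}")
    case False
    show ?thesis by (rule that[OF Km_sub False Km_ne]) (use Km_inv Km_p in auto)
  next
    case Km0: True
    show ?thesis
    proof (cases "Kp = carrier_vec m")
      case False
      show ?thesis by (rule that[OF Kp_sub Kp_ne False]) (use Kp_inv KKp Kp_p in auto)
    next
      case True
      \<comment> \<open>As \<open>Kp\<close> is everything, all these values lie in
        \<open>K\<close>. Being supported in one block they lie in \<open>Km\<close>, which is
        zero.\<close>
      have zero: "?p a (A *\<^sub>v ?p b v) = 0\<^sub>v m" if A: "A \<in> S" "a < ?n" "b < ?n" and v: "v \<in> carrier_vec m" for A a b v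
        using into_Km[OF Kp_inv[OF A] Avc[OF A(1)]] v True Km0 by auto
      obtain v0 where v0: "v0 \<in> K" "v0 \<noteq> 0\<^sub>v m" using K(2) Kd(2) by auto
      have "m \<noteq> 0"
      proof
        assume "m = 0"
        then show False using v0 Kd(1)[OF v0(1)] by (auto simp: vec_eq_iff)
      qed
      \<comment> \<open>In dimension one there is no proper nonzero subspace, so the given
        \<open>K\<close> rules this case out; otherwise the coordinate axis below would not be
        proper.\<close>
      moreover have "m \<noteq> 1"
      proof
        assume m1: "m = 1"
        have "v0 $ 0 \<noteq> 0"
        proof
          assume "v0 $ 0 = 0"
          then have "v0 = 0\<^sub>v m" using Kd(1)[OF v0(1)] m1 by (intro eq_vecI) auto
          then show False using v0 by simp
        qed
        have "w \<in> K" if w: "w \<in> carrier_vec m" for w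
        proof -
          have "w = (w $ 0 / v0 $ 0) \<cdot>\<^sub>v v0" using \<open>v0 $ 0 \<noteq> 0\<close> Kd(1)[OF v0(1)] m1 w by (intro eq_vecI) auto
          then show ?thesis using Kd(4)[OF v0(1)] by metis
        qed
        then show False using K(3) Kd(1) by blast
      qed
      ultimately have m2: "m > 1" by simp
      define L where "L = {v \<in> carrier_vec m. \<forall>i<m. i \<noteq> 0 \<longrightarrow> v $ i = (0 :: complex)}"
      have L_sub: "csubspace m L" by (rule csubspaceI) (auto simp: L_def)
      have "unit_vec m 0 \<in> L" unfolding L_def by auto
      moreover have "unit_vec m 0 \<noteq> (0\<^sub>v m :: complex vec)"
      proof
        assume "unit_vec m 0 = (0\<^sub>v m :: complex vec)"
        then have "unit_vec m 0 $ 0 = (0\<^sub>v m :: complex vec) $ 0" by simp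
        then show False using m2 by simp
      qed
      ultimately have L0: "L \<noteq> {0\<^sub>v m}" by auto
      have "unit_vec m 1 \<notin> L" unfolding L_def using m2 by auto
      then have L1: "L \<noteq> carrier_vec m" by auto
      show ?thesis
      proof (rule that[OF L_sub L0 L1])
        show "?p a (A *\<^sub>v ?p b v) \<in> L" if "A \<in> S" "a < ?n" "b < ?n" "v \<in> L" for A a b v
          using zero[OF that(1-3), of v] that(4) csubspaceD(1,2)[OF L_sub] by simp
        show "?p a v \<in> L" if "a < ?n" "v \<in> L" for a v
          using that pc[of a v] bproj_vec_index[of v ns _ a] unfolding L_def m_def by auto
      qed
    qed
  qed
qed

section \<open>Irreducibility in terms of Kraus operators\<close>

lemma square_mult_closed: "\<forall>X\<in>carrier_mat m m. \<forall>Y\<in>carrier_mat m m. X * Y \<in> carrier_mat m m"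
  by simp

lemma irreducible_map_kraus:
  assumes As: "set As \<subseteq> carrier_mat m m"
    and B: "B \<subseteq> carrier_mat m m" "1\<^sub>m m \<in> B" "\<forall>X\<in>B. \<forall>Y\<in>B. X * Y \<in> B"
    and \<tau>: "\<forall>X\<in>B. \<tau> X \<in> B" "\<forall>X\<in>B. \<tau> X = kraus_sum m As X"
  shows "irreducible_map m B \<tau> \<longleftrightarrow> \<not> (\<exists>P\<in>B. projection m P \<and> P \<noteq> 0\<^sub>m m m \<and> P \<noteq> 1\<^sub>m m \<and>
    (\<forall>A\<in>set As. P * A * (1\<^sub>m m - P) = 0\<^sub>m m m))"
proof -
  have "(projection m P \<and> P \<noteq> 0\<^sub>m m m \<and> P \<noteq> 1\<^sub>m m \<and>
      \<tau> ` {P * X * P | X. X \<in> B} \<subseteq> {P * X * P | X. X \<in> B}) \<longleftrightarrow>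
    (projection m P \<and> P \<noteq> 0\<^sub>m m m \<and> P \<noteq> 1\<^sub>m m \<and>
      (\<forall>A\<in>set As. P * A * (1\<^sub>m m - P) = 0\<^sub>m m m))" if "P \<in> B" for P
  proof (cases "projection m P")
    case True
    show ?thesis unfolding reducing_iff_corner_zero[OF As True that B \<tau>] by (rule refl)
  qed simp
  from bex_cong[OF refl this] show ?thesis unfolding irreducible_map_def by (rule arg_cong)
qed

text \<open>Every Kraus family of an irreducible map generates, not only a well-chosen one: a proper
  invariant subspace would produce a projection with vanishing corners, which reduces the
  map.\<close>

lemma irreducible_map_generating:
  assumes "m > 0" and As: "set As \<subseteq> carrier_mat m m"
    and \<tau>: "\<forall>X\<in>carrier_mat m m. \<tau> X = kraus_sum m As X"
    and irr: "irreducible_map m (carrier_mat m m) \<tau>"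
  shows "gen_alg m (set As) = carrier_mat m m"
proof (rule burnside[OF assms(1)])
  show "gen_alg m (set As) \<subseteq> carrier_mat m m" using gen_alg_carrier by blast
  fix K assume K: "csubspace m K" and inv: "\<And>A v. A \<in> gen_alg m (set As) \<Longrightarrow> v \<in> K \<Longrightarrow> A *\<^sub>v v \<in> K"
  show "K = {0\<^sub>v m} \<or> K = carrier_vec m"
  proof (rule ccontr)
    assume n: "\<not> ?thesis"
    then obtain P where P: "projection m P" "P \<noteq> 0\<^sub>m m m" "P \<noteq> 1\<^sub>m m"
      and Pz: "\<And>A. A \<in> carrier_mat m m \<Longrightarrow> (\<And>v. v \<in> K \<Longrightarrow> A *\<^sub>v v \<in> K) \<Longrightarrow> P * A * (1\<^sub>m m - P) = 0\<^sub>m m m"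
      using invariant_subspace_corner_zero[OF K] by metis
    have "P * A * (1\<^sub>m m - P) = 0\<^sub>m m m" if "A \<in> set As" for A
      using Pz[of A] inv[OF gen_alg.gen[OF that]] that As by blast
    moreover have "P \<in> carrier_mat m m" by (rule projection_carrier[OF P(1)])
    moreover have \<tau>c: "\<forall>X\<in>carrier_mat m m. \<tau> X \<in> carrier_mat m m"
      using \<tau> kraus_sum_carrier[OF As] by simp
    ultimately show False
      using irr[unfolded irreducible_map_kraus[OF As order_refl one_carrier_mat square_mult_closed \<tau>c \<tau>]] P
      by blast
  qed
qed (auto intro: gen_alg.intros)

lemma generating_imp_irreducible_map:
  assumes As: "set As \<subseteq> carrier_mat m m" and gen: "gen_alg m (set As) = carrier_mat m m"
    and B: "B \<subseteq> carrier_mat m m" "1\<^sub>m m \<in> B" "\<forall>X\<in>B. \<forall>Y\<in>B. X * Y \<in> B"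
    and \<tau>: "\<forall>X\<in>B. \<tau> X \<in> B" "\<forall>X\<in>B. \<tau> X = kraus_sum m As X"
  shows "irreducible_map m B \<tau>"
  unfolding irreducible_map_kraus[OF As B \<tau>] using generating_imp_no_corner[OF _ _ _ gen] by blast

lemma irreducible_map_canon_ext:
  fixes ns :: "nat list"
  defines "m \<equiv> sum_list ns"
  assumes lin: "lin_on (blockalg ns) \<tau>" and As: "set As \<subseteq> carrier_mat m m"
    and kraus: "\<forall>X\<in>carrier_mat m m. canon_ext ns \<tau> X = kraus_sum m As X"
    and irr: "irreducible_map m (blockalg ns) \<tau>"
  shows "irreducible_map m (carrier_mat m m) (canon_ext ns \<tau>)"
proof (rule ccontr)
  assume red: "\<not> ?thesis"
  let ?B = "blockalg ns"
  have B: "?B \<subseteq> carrier_mat m m" "1\<^sub>m m \<in> ?B" "\<forall>X\<in>?B. \<forall>Y\<in>?B. X * Y \<in> ?B"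
    unfolding m_def using blockalg_carrier one_in_blockalg mult_in_blockalg by blast+
  have p: "bproj ns a \<in> carrier_mat m m" for a unfolding m_def by (rule bproj_carrier)
  define Bs where "Bs = block_cuts ns As"
  have Bs: "set Bs \<subseteq> carrier_mat m m"
    unfolding Bs_def set_block_cuts using As p by (auto intro!: mult_carrier_mat)
  \<comment> \<open>Cutting the operators takes block-diagonal parts of argument and value. The
    extension ignores the off-diagonal blocks of its argument and produces none, so the map is
    unchanged.\<close>
  have kraus': "\<forall>X\<in>carrier_mat m m. canon_ext ns \<tau> X = kraus_sum m Bs X"
  proof
    fix X :: "complex mat" assume X: "X \<in> carrier_mat m m"
    have bX: "bdiag_part ns X \<in> ?B" by (rule bdiag_part_in_blockalg)
    have "kraus_sum m Bs X = bdiag_part ns (canon_ext ns \<tau> (bdiag_part ns X))"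
      using kraus_sum_block_cuts[of As ns X] As X kraus bX B(1) unfolding Bs_def m_def by auto
    also have "\<dots> = canon_ext ns \<tau> (bdiag_part ns X)" by (rule bdiag_part_id[OF canon_ext_in_blockalg[OF lin]])
    also have "\<dots> = canon_ext ns \<tau> X" unfolding canon_ext_def bdiag_part_id[OF bX] ..
    finally show "canon_ext ns \<tau> X = kraus_sum m Bs X" by simp
  qed
  have ext_c: "\<forall>X\<in>carrier_mat m m. canon_ext ns \<tau> X \<in> carrier_mat m m" using canon_ext_in_blockalg[OF lin] B(1) by blast
  have \<tau>B: "\<forall>X\<in>?B. \<tau> X \<in> ?B" using lin unfolding lin_on_def by blast
  have \<tau>k: "\<forall>X\<in>?B. \<tau> X = kraus_sum m Bs X"
  proof
    fix X assume X: "X \<in> ?B"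
    then show "\<tau> X = kraus_sum m Bs X"
      using bspec[OF kraus' subsetD[OF B(1) X]] bdiag_part_id[OF X] unfolding canon_ext_def by simp
  qed
  from red obtain P where P: "projection m P" "P \<noteq> 0\<^sub>m m m" "P \<noteq> 1\<^sub>m m"
    and Pz: "\<And>A. A \<in> set Bs \<Longrightarrow> P * A * (1\<^sub>m m - P) = 0\<^sub>m m m"
    unfolding irreducible_map_kraus[OF Bs order_refl one_carrier_mat square_mult_closed ext_c kraus'] by blast
  have Pc: "P \<in> carrier_mat m m" by (rule projection_carrier[OF P(1)])
  \<comment> \<open>Vanishing corners mean that this kernel is invariant under every cut operator,
    though it need not be graded.\<close>
  define K where "K = {v \<in> carrier_vec m. P *\<^sub>v v = 0\<^sub>v m}"
  have Qv: "(1\<^sub>m m - P) *\<^sub>v v = v - P *\<^sub>v v" if "v \<in> carrier_vec m" for v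
    using minus_mult_distrib_mat_vec[OF one_carrier_mat Pc that] that by simp
  have K: "csubspace m K"
    by (rule csubspaceI)
      (auto simp: K_def mult_mat_zero_vec[OF Pc] mult_add_distrib_mat_vec[OF Pc] mult_mat_vec[OF Pc])
  have Qc: "1\<^sub>m m - P \<in> carrier_mat m m" by (rule minus_carrier_mat[OF Pc])
  have K0: "K \<noteq> {0\<^sub>v m}"
  proof
    assume K0: "K = {0\<^sub>v m}"
    have "(1\<^sub>m m - P) *\<^sub>v v = 0\<^sub>v m" if v: "v \<in> carrier_vec m" for v
    proof -
      have "P *\<^sub>v ((1\<^sub>m m - P) *\<^sub>v v) = (P * (1\<^sub>m m - P)) *\<^sub>v v"
        by (rule assoc_mult_mat_vec[OF Pc Qc v, symmetric])
      also have "\<dots> = 0\<^sub>v m" unfolding projection_complement(2)[OF P(1)] using v by (intro eq_vecI) auto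
      finally have "(1\<^sub>m m - P) *\<^sub>v v \<in> K" unfolding K_def using Qc v by auto
      then show ?thesis using K0 by simp
    qed
    then have "1\<^sub>m m - P = 0\<^sub>m m m" by (rule mat_zeroI[OF Qc])
    then have "P = 1\<^sub>m m" using projection_complement(4)[OF P(1)] by (auto intro!: eq_matI)
    then show False using P by simp
  qed
  have K1: "K \<noteq> carrier_vec m" using mat_zeroI[OF Pc] P(2) unfolding K_def by blast
  have cut_vec: "(bproj ns a * A * bproj ns b) *\<^sub>v v = bproj ns a *\<^sub>v (A *\<^sub>v (bproj ns b *\<^sub>v v))"
    if "A \<in> set As" "v \<in> carrier_vec m" for A a b v
  proof -
    have A: "A \<in> carrier_mat m m" using that As by auto
    show ?thesis using A p[of a] p[of b] that(2) by (simp add: assoc_mult_mat_vec[of _ m m _ m])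
  qed
  have inv: "bproj ns a *\<^sub>v (A *\<^sub>v (bproj ns b *\<^sub>v v)) \<in> K"
    if A: "A \<in> set As" "a < length ns" "b < length ns" and v: "v \<in> K" for A a b v
  proof -
    define C where "C = bproj ns a * A * bproj ns b"
    have C: "C \<in> set Bs" unfolding C_def Bs_def set_block_cuts using A by blast
    have Cc: "C \<in> carrier_mat m m" using C Bs by auto
    have vc: "v \<in> carrier_vec m" and Pv: "P *\<^sub>v v = 0\<^sub>v m" using v unfolding K_def by auto
    have "(1\<^sub>m m - P) *\<^sub>v v = v" using Qv[OF vc] Pv vc by simp
    then have "P *\<^sub>v (C *\<^sub>v v) = P *\<^sub>v (C *\<^sub>v ((1\<^sub>m m - P) *\<^sub>v v))" by simp
    also have "\<dots> = (P * C * (1\<^sub>m m - P)) *\<^sub>v v" using Pc Cc Qc vc by (simp add: assoc_mult_mat_vec[of _ m m _ m])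
    also have "\<dots> = 0\<^sub>v m" unfolding Pz[OF C] using vc by (intro eq_vecI) auto
    finally have "C *\<^sub>v v \<in> K" unfolding K_def using Cc vc by auto
    then show ?thesis unfolding C_def cut_vec[OF A(1) vc] .
  qed
  obtain L where L: "csubspace m L" "L \<noteq> {0\<^sub>v m}" "L \<noteq> carrier_vec m"
    and Linv: "\<And>A a b v. A \<in> set As \<Longrightarrow> a < length ns \<Longrightarrow> b < length ns \<Longrightarrow> v \<in> L \<Longrightarrow>
      bproj ns a *\<^sub>v (A *\<^sub>v (bproj ns b *\<^sub>v v)) \<in> L"
    and Lp: "\<And>a v. a < length ns \<Longrightarrow> v \<in> L \<Longrightarrow> bproj ns a *\<^sub>v v \<in> L"
  proof (rule graded_invariant_subspace[of "set As" ns K, folded m_def, OF As K K0 K1], goal_cases)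
    case (1 A a b v)
    show ?case using 1(2-5) by (rule inv)
  next
    case (2 L)
    show ?case using 2(2-6) by (rule 2(1))
  qed
  obtain R where R: "projection m R" "R \<noteq> 0\<^sub>m m m" "R \<noteq> 1\<^sub>m m"
    and Rz: "\<And>A. A \<in> carrier_mat m m \<Longrightarrow> (\<And>v. v \<in> L \<Longrightarrow> A *\<^sub>v v \<in> L) \<Longrightarrow> R * A * (1\<^sub>m m - R) = 0\<^sub>m m m"
    using invariant_subspace_corner_zero[OF L] by metis
  have Rc: "R \<in> carrier_mat m m" "cadj R = R" using R(1) unfolding projection_def by auto
  \<comment> \<open>\<open>R\<close> has kernel \<open>L\<close>, which the block projection
    preserves, so \<open>R * p = R * p * R\<close>. The right-hand side is self-adjoint, so taking
    adjoints gives commutation.\<close>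
  have "bproj ns a * R = R * bproj ns a" if a: "a < length ns" for a
  proof -
    let ?p = "bproj ns a"
    have "R * ?p * (1\<^sub>m m - R) = 0\<^sub>m m m" by (rule Rz[OF p Lp[OF a]])
    moreover have "R * ?p * (1\<^sub>m m - R) = R * ?p - R * ?p * R"
      using mult_minus_distrib_mat[of "R * ?p" m m "1\<^sub>m m" m R] Rc p[of a] by simp
    ultimately have "R * ?p - R * ?p * R = 0\<^sub>m m m" by simp
    then have e: "R * ?p = R * ?p * R"
      using Rc(1) p[of a] by (auto simp: mat_eq_iff simp del: index_mult_mat(1))
    have "?p * R = cadj (R * ?p)" using cadj_mult[OF Rc(1) p] Rc(2) cadj_bproj by simp
    also have "\<dots> = cadj (R * ?p * R)" using e by simp
    also have "\<dots> = R * (?p * R)"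
      using cadj_mult[of "R * ?p" m m R m] cadj_mult[OF Rc(1) p] Rc p[of a] cadj_bproj by simp
    also have "\<dots> = R * ?p" using e Rc(1) p[of a] by (simp add: assoc_mult_mat[of _ m m _ m _ m])
    finally show ?thesis .
  qed
  then have "R \<in> ?B" using bproj_commute_in_blockalg[of R ns] Rc unfolding m_def by blast
  moreover have "R * C * (1\<^sub>m m - R) = 0\<^sub>m m m" if C: "C \<in> set Bs" for C
  proof (rule Rz)
    show "C \<in> carrier_mat m m" using C Bs by auto
    fix v assume v: "v \<in> L"
    obtain a A b where "C = bproj ns a * A * bproj ns b" "a < length ns" "A \<in> set As" "b < length ns"
      using C unfolding Bs_def set_block_cuts by blast
    then show "C *\<^sub>v v \<in> L" using cut_vec Linv v csubspaceD(1)[OF L(1) v] by simp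
  qed
  ultimately show False using irr[unfolded irreducible_map_kraus[OF Bs B \<tau>B \<tau>k]] R by blast
qed

text \<open>The corner condition does not mention the algebra, so a reducing projection in the block
  algebra also reduces the extension.\<close>

lemma irreducible_map_restrict:
  fixes ns :: "nat list"
  defines "m \<equiv> sum_list ns"
  assumes lin: "lin_on (blockalg ns) \<tau>" and As: "set As \<subseteq> carrier_mat m m"
    and kraus: "\<forall>X\<in>carrier_mat m m. canon_ext ns \<tau> X = kraus_sum m As X"
    and irr: "irreducible_map m (carrier_mat m m) (canon_ext ns \<tau>)"
  shows "irreducible_map m (blockalg ns) \<tau>"
proof -
  have B: "blockalg ns \<subseteq> carrier_mat m m" "1\<^sub>m m \<in> blockalg ns"
    "\<forall>X\<in>blockalg ns. \<forall>Y\<in>blockalg ns. X * Y \<in> blockalg ns"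
    unfolding m_def using blockalg_carrier one_in_blockalg mult_in_blockalg by blast+
  have ext_c: "\<forall>X\<in>carrier_mat m m. canon_ext ns \<tau> X \<in> carrier_mat m m" using canon_ext_in_blockalg[OF lin] B(1) by blast
  have \<tau>B: "\<forall>X\<in>blockalg ns. \<tau> X \<in> blockalg ns" using lin unfolding lin_on_def by blast
  have \<tau>k: "\<forall>X\<in>blockalg ns. \<tau> X = kraus_sum m As X"
  proof
    fix X assume X: "X \<in> blockalg ns"
    then show "\<tau> X = kraus_sum m As X"
      using bspec[OF kraus subsetD[OF B(1) X]] bdiag_part_id[OF X] unfolding canon_ext_def by simp
  qed
  show ?thesis
    using irr B(1) unfolding irreducible_map_kraus[OF As B \<tau>B \<tau>k]
      irreducible_map_kraus[OF As order_refl one_carrier_mat square_mult_closed ext_c kraus] by blast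
qed

theorem theorem5p10:
  fixes ns :: "nat list" and \<tau> :: "complex mat \<Rightarrow> complex mat"
  defines "m \<equiv> sum_list ns"
  assumes "ns \<noteq> []" and "\<forall>n \<in> set ns. n > 0"
    and "completely_positive m (blockalg ns) \<tau>"
  shows "(irreducible_map m (blockalg ns) \<tau>
            \<longleftrightarrow> irreducible_map m (carrier_mat m m) (canon_ext ns \<tau>))
       \<and> (irreducible_map m (carrier_mat m m) (canon_ext ns \<tau>)
            \<longleftrightarrow> (\<exists>As. set As \<subseteq> carrier_mat m m \<and> gen_alg m (set As) = carrier_mat m m \<and>
                     (\<forall>X \<in> carrier_mat m m. canon_ext ns \<tau> X = kraus_sum m As X)))
       \<and> ((\<exists>As. set As \<subseteq> carrier_mat m m \<and> gen_alg m (set As) = carrier_mat m m \<and>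
                (\<forall>X \<in> carrier_mat m m. canon_ext ns \<tau> X = kraus_sum m As X))
            \<longleftrightarrow> (\<exists>As. set As \<subseteq> carrier_mat m m \<and> gen_alg m (set As) = carrier_mat m m \<and>
                (\<forall>X \<in> blockalg ns. \<tau> X = kraus_sum m As X)))"
    (is "(?I1 \<longleftrightarrow> ?I2) \<and> (?I2 \<longleftrightarrow> ?K3) \<and> (?K3 \<longleftrightarrow> ?K4)")
proof -
  have lin: "lin_on (blockalg ns) \<tau>" using assms(4) unfolding completely_positive_def by simp
  have m: "m > 0" using assms(2,3) unfolding m_def by (cases ns) auto
  obtain As where As: "set As \<subseteq> carrier_mat m m"
    and kraus: "\<forall>X\<in>carrier_mat m m. canon_ext ns \<tau> X = kraus_sum m As X"
    using kraus_decomposition[of ns \<tau>] assms(4) unfolding m_def by blast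
  have B: "blockalg ns \<subseteq> carrier_mat m m" "1\<^sub>m m \<in> blockalg ns"
    "\<forall>X\<in>blockalg ns. \<forall>Y\<in>blockalg ns. X * Y \<in> blockalg ns"
    unfolding m_def using blockalg_carrier one_in_blockalg mult_in_blockalg by blast+
  have 12: "?I1 \<Longrightarrow> ?I2"
    using irreducible_map_canon_ext[OF lin] As kraus unfolding m_def by blast
  have 21: "?I2 \<Longrightarrow> ?I1"
    using irreducible_map_restrict[OF lin] As kraus unfolding m_def by blast
  have 23: "?I2 \<Longrightarrow> ?K3"
    using irreducible_map_generating[OF m As kraus] As kraus by blast
  \<comment> \<open>On the block algebra the extension agrees with \<open>\<tau>\<close>, so the
    same operators serve.\<close>
  have 34: "?K3 \<Longrightarrow> ?K4"
    using B(1) bdiag_part_id unfolding canon_ext_def by (metis subsetD)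
  \<comment> \<open>The family may fail to represent the extension off the block algebra; the
    criterion is therefore applied on the block algebra itself.\<close>
  have 41: "?K4 \<Longrightarrow> ?I1"
    using generating_imp_irreducible_map[OF _ _ B] lin unfolding lin_on_def by blast
  show ?thesis using 12 21 23 34 41 by blast
qed

end
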